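(* Let $d<0$ be the discriminant of an imaginary quadratic field and let $d=q_1^*\cdots q_t^*$ be its factorization into prime discriminants. Assume that $q_t^*\in\{-4,-8\}$, that $q_1^*,\dots,q_{t-1}^*$ are odd, and that the numbering is such that $q_i^*>0$ for $1\le i\le u$ and $q_i^*<0$ for $u<i\le t$, where $0\le u\le t-2$. Let $K_G=\mathbb Q(\sqrt{q_1^*},\dots,\sqrt{q_t^*})\subset\mathbb C$. 1. Define, for $(s_1,\dots,s_{t-1})\in\{0,1\}^{t-1}$, $$\beta_{s_1,\dots,s_{t-1}}=\left(\prod_{i=1}^u\tilde\alpha_i^{s_i}\alpha_i^{1-s_i}\right)\left(\left(\prod_{i=u+1}^{t-2}\tilde\alpha_i^{s_i}\alpha_i^{1-s_i}\right)\alpha_{t-1}\alpha_t^{s_{t-1}}+\left(\prod_{i=u+1}^{t-2}\tilde\alpha_i^{1-s_i}\alpha_i^{s_i}\right)\tilde\alpha_{t-1}(-\alpha_t)^{s_{t-1}}\right).$$ The set $\{\beta_{s_1,\dots,s_{t-1}}:(s_1,\dots,s_{t-1})\in\{0,1\}^{t-1}\}$ is a $\mathbb Z$-basis of the ring of integers of $K_G\cap\mathbb R$. 2. Define $$\beta^*_{s_1,\dots,s_{t-1}}=\left(\prod_{i=1}^u(-\tilde\alpha_i)^{s_i}\alpha_i^{1-s_i}\right)\left(\left(\prod_{i=u+1}^{t-2}(-\tilde\alpha_i)^{s_i}\alpha_i^{1-s_i}\right)\alpha_{t-1}\alpha_t^{1-s_{t-1}}-\left(\prod_{i=u+1}^{t-2}\tilde\alpha_i^{1-s_i}(-\alpha_i)^{s_i}\right)\tilde\alpha_{t-1}(-\alpha_t)^{1-s_{t-1}}\right).$$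 The set $\{\beta^*_{s_1,\dots,s_{t-1}}:(s_1,\dots,s_{t-1})\in\{0,1\}^{t-1}\}$ is a $\mathbb Z$-basis of the $\mathbb Z$-module $\mathcal O_{K_G}\cap i\mathbb R$. 3. For any $\eta,\nu\in\{0,1\}^{t-1}$, $$\sum_{\mu\in\{0,1\}^{t-1}}(-1)^{\mu_1+\dots+\mu_{t-1}}\tau_\mu\left(\beta_{\eta_1,\dots,\eta_{t-1}}\beta^*_{\nu_1,\dots,\nu_{t-1}}\right)=\begin{cases}\sqrt d,&\text{if }\eta=\nu,\\0,&\text{otherwise.}\end{cases}$$
   Context: The factorization of $d$ into prime discriminants is the unique (up to order) representation $d=q_1^*\cdots q_t^*$ with pairwise relatively prime $q_i^*$, each being either $(-1)^{(q-1)/2}q$ for an odd prime $q>0$ or an element of $\{-4,8,-8\}$. Fix a complex square root $\sqrt{q_i^*}$ for each $i$; $\sqrt d$ denotes the square root of $d$ equal to $\sqrt{q_1^*}\cdots\sqrt{q_t^*}$. For $i\le t-1$ put $\alpha_i=\frac{1+\sqrt{q_i^*}}2$, $\tilde\alpha_i=\frac{1-\sqrt{q_i^*}}2$, and put $\alpha_t=\sqrt{q_t^*/4}=\frac12\sqrt{q_t^*}$. One has $[K_G:\mathbb Q]=2^t$, and for $1\le j\le t$, $\tau_j\in\mathrm{Gal}(K_G/\mathbb Q)$ is the automorphism with $\tau_j(\sqrt{q_j^*})=-\sqrt{q_j^*}$ and $\tau_j(\sqrt{q_i^*})=\sqrt{q_i^*}$ for $i\neq j$. For $\lambda\in\{0,1\}^{t-1}$,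 $\tau_\lambda=\tau_1^{\lambda_1}\cdots\tau_{t-1}^{\lambda_{t-1}}$. $\mathcal O_{K_G}$ is the ring of integers of $K_G$. Empty products equal $1$. *)

theory Defs
  imports
    "HOL-Analysis.Analysis"
    "HOL-Algebra.Generated_Fields"
    "HOL-Algebra.Embedded_Algebras"
    "HOL-Algebra.QuotRing"
    "HOL-Algebra.Algebraic_Closure_Type"
begin

text \<open>Number fields are subfields of the complex numbers, represented by their carrier sets
  inside the complex field viewed as a \<^verbatim>\<open>HOL-Algebra\<close> ring.\<close>

abbreviation complex_field :: "complex ring" where
  "complex_field \<equiv> ring_of_type_algebra"

definition ring_of_integers :: "complex set \<Rightarrow> complex set" where
  "ring_of_integers K = {x \<in> K. algebraic_int x}"

text \<open>The theory name in \<^verbatim>\<open>Modules.module\<close> selects the type-class based locale rather than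
  the \<^verbatim>\<open>HOL-Algebra\<close> locale of the same name.\<close>

abbreviation int_scale :: "int \<Rightarrow> complex \<Rightarrow> complex" where
  "int_scale k z \<equiv> of_int k * z"

definition is_Z_basis :: "complex set \<Rightarrow> complex set \<Rightarrow> bool" where
  "is_Z_basis B M \<longleftrightarrow>
     \<not> Modules.module.dependent int_scale B \<and> Modules.module.span int_scale B = M"

text \<open>Every field automorphism fixes the rational numbers. Automorphisms are taken to be
  extensional so that they are determined by their values on \<open>K\<close>.\<close>

definition Gal :: "complex set \<Rightarrow> (complex \<Rightarrow> complex) set" where
  "Gal K = ring_iso (complex_field\<lparr>carrier := K\<rparr>) (complex_field\<lparr>carrier := K\<rparr>) \<inter> extensional K"

definition imaginary_quadratic_field :: "complex set \<Rightarrow> bool" where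
  "imaginary_quadratic_field F \<longleftrightarrow>
     subfield F complex_field \<and> ring.dimension complex_field 2 \<rat> F \<and> \<not> F \<subseteq> \<real>"

text \<open>The discriminant is the square of the determinant of the conjugates of an integral basis;
  a quadratic field has the two embeddings \<open>id\<close> and \<open>\<sigma>\<close>.\<close>

definition is_discriminant_of_quadratic_field :: "complex set \<Rightarrow> int \<Rightarrow> bool" where
  "is_discriminant_of_quadratic_field F d \<longleftrightarrow>
     (\<exists>w1 w2 \<sigma>. is_Z_basis {w1, w2} (ring_of_integers F) \<and>
        \<sigma> \<in> Gal F \<and> (\<exists>x\<in>F. \<sigma> x \<noteq> x) \<and>
        of_int d = (w1 * \<sigma> w2 - w2 * \<sigma> w1)\<^sup>2)"

definition prime_discriminant :: "int \<Rightarrow> bool" where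
  "prime_discriminant m \<longleftrightarrow>
     (\<exists>p::nat. normalization_semidom_class.prime p \<and> odd p \<and> m = (-1) ^ ((p - 1) div 2) * int p) \<or> m \<in> {-4, 8, -8}"

definition prime_discriminant_factorization :: "int \<Rightarrow> nat \<Rightarrow> (nat \<Rightarrow> int) \<Rightarrow> bool" where
  "prime_discriminant_factorization d t q \<longleftrightarrow>
     d = (\<Prod>i\<in>{1..t}. q i) \<and>
     (\<forall>i\<in>{1..t}. prime_discriminant (q i)) \<and>
     (\<forall>i\<in>{1..t}. \<forall>j\<in>{1..t}. i \<noteq> j \<longrightarrow> coprime (q i) (q j))"

text \<open>Below, \<open>r i\<close> is the chosen complex square root of the \<open>i\<close>-th prime discriminant, for
  \<open>1 \<le> i \<le> t\<close>.\<close>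

definition genus_field :: "nat \<Rightarrow> (nat \<Rightarrow> complex) \<Rightarrow> complex set" where
  "genus_field t r = generate_field complex_field (r ` {1..t})"

definition tau :: "nat \<Rightarrow> (nat \<Rightarrow> complex) \<Rightarrow> nat \<Rightarrow> complex \<Rightarrow> complex" where
  "tau t r j = (THE \<sigma>. \<sigma> \<in> Gal (genus_field t r) \<and> \<sigma> (r j) = - r j \<and>
                      (\<forall>i\<in>{1..t}. i \<noteq> j \<longrightarrow> \<sigma> (r i) = r i))"

definition tau_prod :: "nat \<Rightarrow> (nat \<Rightarrow> complex) \<Rightarrow> (nat \<Rightarrow> nat) \<Rightarrow> complex \<Rightarrow> complex" where
  "tau_prod t r l = foldr (\<circ>) (map (\<lambda>j. tau t r j ^^ l j) [1..<t]) id"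

text \<open>The index set \<open>{0,1}\<close> to the power \<open>n\<close>, as extensional functions on \<open>{1..n}\<close>.\<close>

definition bits :: "nat \<Rightarrow> (nat \<Rightarrow> nat) set" where
  "bits n = {1..n} \<rightarrow>\<^sub>E {0, 1}"

definition alpha :: "nat \<Rightarrow> (nat \<Rightarrow> complex) \<Rightarrow> nat \<Rightarrow> complex" where
  "alpha t r i = (if i = t then r t / 2 else (1 + r i) / 2)"

definition alpha_conj :: "(nat \<Rightarrow> complex) \<Rightarrow> nat \<Rightarrow> complex" where
  "alpha_conj r i = (1 - r i) / 2"

definition beta :: "nat \<Rightarrow> nat \<Rightarrow> (nat \<Rightarrow> complex) \<Rightarrow> (nat \<Rightarrow> nat) \<Rightarrow> complex" where
  "beta t u r s =
     (let a = alpha t r; a' = alpha_conj r in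
      (\<Prod>i\<in>{1..u}. a' i ^ s i * a i ^ (1 - s i)) *
      ((\<Prod>i\<in>{u+1..t-2}. a' i ^ s i * a i ^ (1 - s i)) * a (t-1) * a t ^ s (t-1)
       + (\<Prod>i\<in>{u+1..t-2}. a' i ^ (1 - s i) * a i ^ s i) * a' (t-1) * (- a t) ^ s (t-1)))"

definition beta_star :: "nat \<Rightarrow> nat \<Rightarrow> (nat \<Rightarrow> complex) \<Rightarrow> (nat \<Rightarrow> nat) \<Rightarrow> complex" where
  "beta_star t u r s =
     (let a = alpha t r; a' = alpha_conj r in
      (\<Prod>i\<in>{1..u}. (- a' i) ^ s i * a i ^ (1 - s i)) *
      ((\<Prod>i\<in>{u+1..t-2}. (- a' i) ^ s i * a i ^ (1 - s i)) * a (t-1) * a t ^ (1 - s (t-1))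
       - (\<Prod>i\<in>{u+1..t-2}. a' i ^ (1 - s i) * (- a i) ^ s i) * a' (t-1) * (- a t) ^ (1 - s (t-1))))"

end

theory Submission
  imports Defs "Jordan_Normal_Form.Char_Poly"
begin

text \<open>Let \<open>K\<close> be the genus field. The argument rests on an integral basis of the whole field \<open>K\<close> on which
both the Galois group and complex conjugation act by permuting indices.

For \<open>w \<in> {0,1}\<^sup>t\<^sup>-\<^sup>1\<close> let \<open>E w\<close> be the product over \<open>i < t\<close> of \<open>\<alpha>\<^sub>i\<close> or its conjugate
\<open>1 - \<alpha>\<^sub>i\<close>, according to the bit \<open>w i\<close> (\<open>alpha_prod\<close> below). The automorphism \<open>\<tau>\<^sub>\<mu>\<close> sends \<open>E w\<close> to the product
with index \<open>w\<close> xor \<open>\<mu>\<close>. Since \<open>\<alpha>\<^sub>i\<^sup>2 - (1 - \<alpha>\<^sub>i)\<^sup>2 = \<surd>q\<^sub>i\<^sup>*\<close>, whereas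
\<open>\<alpha>\<^sub>i (1 - \<alpha>\<^sub>i)\<close> is invariant, the signed trace \<open>\<Sum>\<mu>. (-1)\<^sup>|\<^sup>\<mu>\<^sup>| \<tau>\<^sub>\<mu>\<close>, which is the product of all
\<open>1 - \<tau>\<^sub>i\<close>, makes the family \<open>E\<close> dual to itself up to signs: it maps \<open>g E w E v\<close> to
\<open>0\<close> if \<open>w \<noteq> v\<close> and to \<open>\<plusminus> g R\<close> if \<open>w = v\<close>, where \<open>g\<close> lies in \<open>\<rat>(\<surd>q\<^sub>t\<^sup>*)\<close> and \<open>R\<close> is the product of the
\<open>\<surd>q\<^sub>i\<^sup>*\<close> with \<open>i < t\<close> (lemma \<open>sign_trace_dual\<close>).

Every \<open>x\<close> in \<open>K\<close> is a combination of the \<open>E w\<close> with coefficients \<open>y w\<close> in \<open>\<rat>(\<surd>q\<^sub>t\<^sup>*)\<close>. If \<open>x\<close> is an algebraic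
integer, duality shows that every \<open>R y w\<close> is one. As \<open>R\<^sup>2\<close> is odd and squarefree, looking at the norm and at the
trace of the square of \<open>R y w\<close> forces \<open>y w \<in> \<int>[\<alpha>\<^sub>t]\<close>. Hence the numbers \<open>E w\<close> and \<open>\<alpha>\<^sub>t E w\<close> form an integral
basis of \<open>K\<close> (theorem \<open>integral_basis_of_genus_field\<close>).

Complex conjugation flips the bits with index between \<open>u + 1\<close> and \<open>t - 1\<close> and negates \<open>\<alpha>\<^sub>t\<close>. Because \<open>u < t - 1\<close>
it permutes the indices without fixed points, so its \<open>\<plusminus>1\<close>-eigenspaces in the ring of integers have as bases the
sums of a basis element and \<open>\<plusminus>\<close> its conjugate, one for each orbit. Representing an orbit by its member
with last bit \<open>0\<close>, these are exactly the \<open>\<beta>\<close> and, up to sign, the \<open>\<beta>\<^sup>*\<close>.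

For the duality of \<open>\<beta>\<close> and \<open>\<beta>\<^sup>*\<close>, expand the product into four terms \<open>g E w E v\<close> and apply the duality of the
\<open>E w\<close>. The two mixed terms vanish, because there \<open>w\<close> and \<open>v\<close> differ in the last bit. The two remaining ones have
equal signs, as the number of negative \<open>q\<^sub>i\<^sup>*\<close> is odd by \<open>d < 0\<close>, and combine to \<open>2 \<alpha>\<^sub>t R = \<surd>d\<close> or cancel.\<close>


section \<open>Algebraic integers form a ring\<close>

text \<open>The relations say that the vector \<open>v\<close> is an eigenvector of the integer matrix \<open>M\<close> with eigenvalue \<open>z\<close>, so \<open>z\<close> is a
root of the characteristic polynomial of \<open>M\<close>, which is monic with integer coefficients.\<close>

lemma algebraic_int_if_stabilises_fg_module_nat:
  fixes z :: complex and v :: "nat \<Rightarrow> complex" and M :: "nat \<Rightarrow> nat \<Rightarrow> int"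
  assumes stable: "\<And>i. i < n \<Longrightarrow> z * v i = (\<Sum>j<n. of_int (M i j) * v j)"
    and nonzero: "k < n" "v k \<noteq> 0"
  shows "algebraic_int z"
proof -
  define A where "A = Matrix.mat n n (\<lambda>(i, j). M i j)"
  define A' where "A' = map_mat complex_of_int A"
  have A: "A \<in> carrier_mat n n" and A': "A' \<in> carrier_mat n n"
    by (auto simp: A_def A'_def)
  have "eigenvector A' (Matrix.vec n v) z"
    unfolding eigenvector_def
  proof (intro conjI)
    show "Matrix.vec n v \<in> carrier_vec (dim_row A')" using A' by auto
    show "Matrix.vec n v \<noteq> 0\<^sub>v (dim_row A')"
    proof
      assume "Matrix.vec n v = 0\<^sub>v (dim_row A')"
      hence "vec_index (Matrix.vec n v) k = vec_index (0\<^sub>v (dim_row A')) k" by simp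
      thus False using nonzero A' by simp
    qed
    show "A' *\<^sub>v Matrix.vec n v = z \<cdot>\<^sub>v Matrix.vec n v"
      using stable by (intro eq_vecI)
        (auto simp: A'_def A_def scalar_prod_def atLeast0LessThan)
  qed
  hence "poly (char_poly A') z = 0"
    using eigenvalue_root_char_poly[OF A'] by (auto simp: eigenvalue_def)
  moreover have "char_poly A' = map_poly complex_of_int (char_poly A)"
    unfolding A'_def by (rule of_int_hom.char_poly_hom[OF A])
  moreover have "Polynomial.lead_coeff (char_poly A) = 1"
    using degree_monic_char_poly[OF A] by simp
  ultimately show ?thesis unfolding algebraic_int_altdef_ipoly by auto
qed

definition int_combinations :: "('i \<Rightarrow> complex) \<Rightarrow> 'i set \<Rightarrow> complex set" where
  "int_combinations v I = {\<Sum>i\<in>I. of_int (c i) * v i | c. True}"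

lemma int_combinationsI: "x = (\<Sum>i\<in>I. of_int (c i) * v i) \<Longrightarrow> x \<in> int_combinations v I"
  by (auto simp: int_combinations_def)

lemma int_combinations_add:
  assumes "x \<in> int_combinations v I" "y \<in> int_combinations v I"
  shows "x + y \<in> int_combinations v I"
proof -
  from assms obtain c e where "x = (\<Sum>i\<in>I. of_int (c i) * v i)" "y = (\<Sum>i\<in>I. of_int (e i) * v i)"
    by (auto simp: int_combinations_def)
  thus ?thesis by (intro int_combinationsI[of _ "\<lambda>i. c i + e i"]) (simp add: sum.distrib algebra_simps)
qed

lemma int_combinations_scale:
  assumes "x \<in> int_combinations v I"
  shows "of_int k * x \<in> int_combinations v I"
proof -
  from assms obtain c where "x = (\<Sum>i\<in>I. of_int (c i) * v i)"
    by (auto simp: int_combinations_def)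
  thus ?thesis by (intro int_combinationsI[of _ "\<lambda>i. k * c i"]) (simp add: sum_distrib_left algebra_simps)
qed

lemma int_combinations_gen: "finite I \<Longrightarrow> i \<in> I \<Longrightarrow> v i \<in> int_combinations v I"
  by (rule int_combinationsI[of _ "\<lambda>j. if j = i then 1 else 0"])
    (simp add: if_distrib if_distribR sum.delta cong: if_cong)

lemma int_combinations_sum:
  assumes "\<And>j. j \<in> J \<Longrightarrow> x j \<in> int_combinations v I"
  shows "(\<Sum>j\<in>J. of_int (c j) * x j) \<in> int_combinations v I"
  using assms
proof (induction J rule: infinite_finite_induct)
  case (insert j J)
  thus ?case by (auto intro: int_combinations_add int_combinations_scale)
qed (auto intro: int_combinationsI[of _ "\<lambda>_. 0"])

lemma algebraic_int_if_stabilises_fg_module: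
  assumes "finite I" and stable: "\<And>i. i \<in> I \<Longrightarrow> z * v i \<in> int_combinations v I"
    and nonzero: "k \<in> I" "v k \<noteq> 0"
  shows "algebraic_int z"
proof -
  obtain h where h: "bij_betw h {..<card I} I"
    using ex_bij_betw_nat_finite[OF \<open>finite I\<close>] by (auto simp: atLeast0LessThan)
  have "\<forall>i\<in>I. \<exists>c. z * v i = (\<Sum>j\<in>I. of_int (c j) * v j)"
    using stable by (fastforce simp: int_combinations_def)
  then obtain C where C: "\<And>i. i \<in> I \<Longrightarrow> z * v i = (\<Sum>j\<in>I. of_int (C i j) * v j)"
    by metis
  from h nonzero obtain k' where k': "k' < card I" "h k' = k"
    by (metis bij_betw_imp_surj_on imageE lessThan_iff)
  show ?thesis
  proof (rule algebraic_int_if_stabilises_fg_module_nat)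
    fix i assume "i < card I"
    hence "h i \<in> I" using h by (auto simp: bij_betw_def)
    thus "z * v (h i) = (\<Sum>j<card I. of_int (C (h i) (h j)) * v (h j))"
      unfolding C[OF \<open>h i \<in> I\<close>] by (simp add: sum.reindex_bij_betw[OF h, of "\<lambda>j. of_int (C (h i) j) * v j"])
  next
    show "k' < card I" "v (h k') \<noteq> 0" using k' nonzero by auto
  qed
qed

lemma algebraic_int_power_reduction:
  assumes "algebraic_int (x :: complex)"
  obtains n where "n > 0" "x ^ n \<in> int_combinations (\<lambda>i. x ^ i) {..<n}"
proof -
  from assms obtain p where p: "poly (map_poly of_int p) x = 0" "Polynomial.lead_coeff p = 1"
    unfolding algebraic_int_altdef_ipoly by auto
  have "Polynomial.degree (map_poly complex_of_int p) = Polynomial.degree p" by (simp add: degree_map_poly)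
  hence "(\<Sum>i\<le>Polynomial.degree p. of_int (Polynomial.coeff p i) * x ^ i) = 0"
    using p(1) unfolding poly_altdef by (simp add: coeff_map_poly)
  hence "x ^ Polynomial.degree p = (\<Sum>i<Polynomial.degree p. of_int (- Polynomial.coeff p i) * x ^ i)"
    using p(2) by (simp add: sum.lessThan_Suc[symmetric] lessThan_Suc_atMost[symmetric] sum_negf
        add_eq_0_iff)
  moreover have "Polynomial.degree p > 0"
  proof (rule ccontr)
    assume "\<not> ?thesis"
    then obtain c where "p = [:c:]" by (auto elim: degree_eq_zeroE)
    thus False using p by simp
  qed
  ultimately show ?thesis by (intro that int_combinationsI)
qed

text \<open>Both \<open>x + y\<close> and \<open>x y\<close> stabilise the finitely generated group \<open>\<int>[x, y]\<close>, which is spanned by the monomials whose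
exponents stay below the degrees of monic equations for \<open>x\<close> and \<open>y\<close>.\<close>

lemma algebraic_int_add_mult:
  fixes x y :: complex
  assumes "algebraic_int x" "algebraic_int y"
  shows "algebraic_int (x + y)" "algebraic_int (x * y)"
proof -
  obtain n where n: "n > 0" "x ^ n \<in> int_combinations (\<lambda>i. x ^ i) {..<n}"
    using algebraic_int_power_reduction[OF assms(1)] .
  obtain m where m: "m > 0" "y ^ m \<in> int_combinations (\<lambda>i. y ^ i) {..<m}"
    using algebraic_int_power_reduction[OF assms(2)] .
  define I where "I = {..<n} \<times> {..<m}"
  define v where "v = (\<lambda>(i, j). x ^ i * y ^ j)"
  have fin: "finite I" by (simp add: I_def)
  have mult_x: "x * v a \<in> int_combinations v I" if "a \<in> I" for a
  proof -
    obtain i j where a: "a = (i, j)" "i < n" "j < m" using \<open>a \<in> I\<close> unfolding I_def by blast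
    show ?thesis
    proof (cases "Suc i < n")
      case True
      have "x * v a = v (Suc i, j)" by (simp add: v_def a)
      thus ?thesis using True a fin by (auto simp: I_def intro!: int_combinations_gen)
    next
      case False
      hence "n = Suc i" using a by auto
      from n(2) obtain c where c: "x ^ n = (\<Sum>k<n. of_int (c k) * x ^ k)"
        by (auto simp: int_combinations_def)
      have "x * v a = x ^ n * y ^ j" by (simp add: v_def a \<open>n = Suc i\<close>)
      also have "\<dots> = (\<Sum>k<n. of_int (c k) * v (k, j))"
        by (simp add: c v_def sum_distrib_right mult.assoc)
      also have "\<dots> \<in> int_combinations v I"
        using a fin by (intro int_combinations_sum int_combinations_gen) (auto simp: I_def)
      finally show ?thesis .
    qed
  qed
  have mult_y: "y * v a \<in> int_combinations v I" if "a \<in> I" for a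
  proof -
    obtain i j where a: "a = (i, j)" "i < n" "j < m" using \<open>a \<in> I\<close> unfolding I_def by blast
    show ?thesis
    proof (cases "Suc j < m")
      case True
      have "y * v a = v (i, Suc j)" by (simp add: v_def a)
      thus ?thesis using True a fin by (auto simp: I_def intro!: int_combinations_gen)
    next
      case False
      hence "m = Suc j" using a by auto
      from m(2) obtain c where c: "y ^ m = (\<Sum>k<m. of_int (c k) * y ^ k)"
        by (auto simp: int_combinations_def)
      have "y * v a = x ^ i * y ^ m" by (simp add: v_def a \<open>m = Suc j\<close>)
      also have "\<dots> = (\<Sum>k<m. of_int (c k) * v (i, k))"
        by (simp add: c v_def sum_distrib_left algebra_simps)
      also have "\<dots> \<in> int_combinations v I"
        using a fin by (intro int_combinations_sum int_combinations_gen) (auto simp: I_def)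
      finally show ?thesis .
    qed
  qed
  have mult_x': "x * w \<in> int_combinations v I" if w: "w \<in> int_combinations v I" for w
  proof -
    obtain c where c: "w = (\<Sum>a\<in>I. of_int (c a) * v a)"
      using w by (auto simp: int_combinations_def)
    have "x * w = (\<Sum>a\<in>I. of_int (c a) * (x * v a))"
      unfolding c by (simp add: sum_distrib_left algebra_simps)
    thus ?thesis using mult_x by (auto intro: int_combinations_sum)
  qed
  have one: "(0, 0) \<in> I" "v (0, 0) \<noteq> 0" using n m by (auto simp: I_def v_def)
  show "algebraic_int (x + y)"
    by (rule algebraic_int_if_stabilises_fg_module[of I _ v, OF fin _ one])
      (auto simp: distrib_right intro: int_combinations_add mult_x mult_y)
  show "algebraic_int (x * y)"
    by (rule algebraic_int_if_stabilises_fg_module[of I _ v, OF fin _ one])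
      (auto simp: mult.assoc intro: mult_x' mult_y)
qed

lemma algebraic_int_sum:
  "(\<And>i. i \<in> I \<Longrightarrow> algebraic_int (f i :: complex)) \<Longrightarrow> algebraic_int (\<Sum>i\<in>I. f i)"
  by (induction I rule: infinite_finite_induct) (auto intro: algebraic_int_add_mult)

lemma algebraic_int_prod:
  "(\<And>i. i \<in> I \<Longrightarrow> algebraic_int (f i :: complex)) \<Longrightarrow> algebraic_int (\<Prod>i\<in>I. f i)"
  by (induction I rule: infinite_finite_induct) (auto intro: algebraic_int_add_mult)

lemma algebraic_int_quadratic:
  fixes x :: complex
  assumes "x\<^sup>2 + of_int b * x + of_int c = 0"
  shows "algebraic_int x"
proof (rule algebraic_int.intros[of "[:of_int c, of_int b, 1:]"])
  show "\<forall>i. Polynomial.coeff [:of_int c, of_int b, 1:] i \<in> (\<int> :: complex set)"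
    by (auto simp: coeff_pCons split: nat.splits)
  show "poly [:of_int c, of_int b, 1:] x = 0"
    using assms by (simp add: power2_eq_square algebra_simps)
qed simp


section \<open>Subfields of the complex numbers and their endomorphisms\<close>

lemma complex_field_simps [simp]:
  "carrier complex_field = UNIV" "x \<otimes>\<^bsub>complex_field\<^esub> y = x * y" "x \<oplus>\<^bsub>complex_field\<^esub> y = x + y"
  "\<one>\<^bsub>complex_field\<^esub> = 1" "\<zero>\<^bsub>complex_field\<^esub> = 0"
  by (simp_all add: ring_of_type_algebra_def)

lemma complex_field_uminus [simp]: "\<ominus>\<^bsub>complex_field\<^esub> x = - x"
proof -
  interpret cring complex_field by (rule cring_from_type_algebra)
  show ?thesis by (rule minus_equality) simp_all
qed

lemma complex_field_inverse [simp]: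
  assumes "x \<noteq> 0"
  shows "inv\<^bsub>complex_field\<^esub> x = inverse x"
proof -
  interpret cring complex_field by (rule cring_from_type_algebra)
  show ?thesis by (rule comm_inv_char) (use assms in simp_all)
qed

text \<open>All later arguments use the type-class operations on complex numbers; this constant separates them from the ring
record in terms of which generated fields are defined.\<close>

definition adjoin :: "complex set \<Rightarrow> complex set" where
  "adjoin H = generate_field complex_field H"

named_theorems adjoin_intros

lemma adjoin_1 [adjoin_intros]: "1 \<in> adjoin H"
  using generate_field.one[of complex_field H] by (simp add: adjoin_def)

lemma adjoin_gen: "x \<in> H \<Longrightarrow> x \<in> adjoin H"
  using generate_field.incl[of x H complex_field] by (simp add: adjoin_def)

lemma adjoin_uminus [adjoin_intros]: "x \<in> adjoin H \<Longrightarrow> - x \<in> adjoin H"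
  using generate_field.a_inv[of x complex_field H] by (simp add: adjoin_def)

lemma adjoin_add [adjoin_intros]: "x \<in> adjoin H \<Longrightarrow> y \<in> adjoin H \<Longrightarrow> x + y \<in> adjoin H"
  using generate_field.eng_add[of x complex_field H y] by (simp add: adjoin_def)

lemma adjoin_mult [adjoin_intros]: "x \<in> adjoin H \<Longrightarrow> y \<in> adjoin H \<Longrightarrow> x * y \<in> adjoin H"
  using generate_field.eng_mult[of x complex_field H y] by (simp add: adjoin_def)

lemma adjoin_0 [adjoin_intros]: "0 \<in> adjoin H"
  using adjoin_add[OF adjoin_1 adjoin_uminus[OF adjoin_1]] by simp

lemma adjoin_inverse [adjoin_intros]: "x \<in> adjoin H \<Longrightarrow> inverse x \<in> adjoin H"
  using generate_field.m_inv[of x complex_field H] adjoin_0[of H]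
  by (cases "x = 0") (simp_all add: adjoin_def)

lemma adjoin_diff [adjoin_intros]: "x \<in> adjoin H \<Longrightarrow> y \<in> adjoin H \<Longrightarrow> x - y \<in> adjoin H"
  using adjoin_add[OF _ adjoin_uminus, of x H y] by simp

lemma adjoin_divide [adjoin_intros]: "x \<in> adjoin H \<Longrightarrow> y \<in> adjoin H \<Longrightarrow> x / y \<in> adjoin H"
  using adjoin_mult[OF _ adjoin_inverse, of x H y] by (simp add: field_simps)

lemma adjoin_power [adjoin_intros]: "x \<in> adjoin H \<Longrightarrow> x ^ n \<in> adjoin H"
  by (induction n) (auto intro: adjoin_intros)

lemma adjoin_of_nat [adjoin_intros]: "of_nat n \<in> adjoin H"
  by (induction n) (auto intro: adjoin_intros)

lemma adjoin_of_int [adjoin_intros]: "of_int n \<in> adjoin H"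
  by (cases n rule: int_cases2) (auto intro: adjoin_intros)

lemma adjoin_numeral [adjoin_intros]: "numeral n \<in> adjoin H"
  using adjoin_of_nat[of "numeral n"] by simp

lemma adjoin_Rats: "x \<in> \<rat> \<Longrightarrow> x \<in> adjoin H"
  by (auto elim!: Rats_cases' intro!: adjoin_intros)

lemma adjoin_sum [adjoin_intros]: "(\<And>i. i \<in> I \<Longrightarrow> f i \<in> adjoin H) \<Longrightarrow> sum f I \<in> adjoin H"
  by (induction I rule: infinite_finite_induct) (auto intro: adjoin_intros)

lemma adjoin_prod [adjoin_intros]: "(\<And>i. i \<in> I \<Longrightarrow> f i \<in> adjoin H) \<Longrightarrow> prod f I \<in> adjoin H"
  by (induction I rule: infinite_finite_induct) (auto intro: adjoin_intros)

lemma adjoin_induct [consumes 1, case_names one gen uminus inverse add mult]: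
  assumes "x \<in> adjoin H"
    and "P 1" "\<And>x. x \<in> H \<Longrightarrow> P x"
    and "\<And>x. x \<in> adjoin H \<Longrightarrow> P x \<Longrightarrow> P (- x)"
    and "\<And>x. x \<in> adjoin H \<Longrightarrow> x \<noteq> 0 \<Longrightarrow> P x \<Longrightarrow> P (inverse x)"
    and "\<And>x y. x \<in> adjoin H \<Longrightarrow> y \<in> adjoin H \<Longrightarrow> P x \<Longrightarrow> P y \<Longrightarrow> P (x + y)"
    and "\<And>x y. x \<in> adjoin H \<Longrightarrow> y \<in> adjoin H \<Longrightarrow> P x \<Longrightarrow> P y \<Longrightarrow> P (x * y)"
  shows "P x"
  using assms(1) unfolding adjoin_def
  by (induction rule: generate_field.induct) (use assms(2-) in \<open>auto simp: adjoin_def\<close>)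

lemma adjoin_mono:
  assumes "H \<subseteq> H'"
  shows "adjoin H \<subseteq> adjoin H'"
proof
  fix x assume "x \<in> adjoin H"
  thus "x \<in> adjoin H'"
    by (induction rule: adjoin_induct) (use assms in \<open>auto intro: adjoin_intros adjoin_gen\<close>)
qed

lemma adjoin_empty: "adjoin {} = \<rat>"
proof
  show "adjoin {} \<subseteq> \<rat>"
  proof
    fix x assume "x \<in> adjoin {}"
    thus "x \<in> \<rat>" by (induction rule: adjoin_induct) auto
  qed
qed (auto intro: adjoin_Rats)

text \<open>The right-hand side is closed under inverses by the usual conjugation trick
\<open>(a + b r) (a - b r) = a\<^sup>2 - b\<^sup>2 r\<^sup>2\<close>.\<close>

lemma adjoin_insert_sqrt:
  assumes r: "r\<^sup>2 \<in> adjoin H"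
  shows "adjoin (insert r H) = {a + b * r | a b. a \<in> adjoin H \<and> b \<in> adjoin H}" (is "_ = ?S")
proof
  have SI: "a + b * r \<in> ?S" if "a \<in> adjoin H" "b \<in> adjoin H" for a b
    using that by blast
  show "adjoin (insert r H) \<subseteq> ?S"
  proof
    fix x assume "x \<in> adjoin (insert r H)"
    thus "x \<in> ?S"
    proof (induction rule: adjoin_induct)
      case one
      show ?case using SI[of 1 0] by (simp add: adjoin_intros)
    next
      case (gen x)
      thus ?case using SI[of 0 1] SI[of x 0] by (auto simp: adjoin_intros adjoin_gen)
    next
      case (uminus x)
      then obtain a b where "x = a + b * r" "a \<in> adjoin H" "b \<in> adjoin H" by blast
      thus ?case using SI[of "-a" "-b"] by (simp add: adjoin_intros)
    next
      case (inverse x)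
      then obtain a b where x: "x = a + b * r" "a \<in> adjoin H" "b \<in> adjoin H" by blast
      show ?case
      proof (cases "a = b * r")
        case True
        \<comment> \<open>Here the conjugate of \<open>x\<close> vanishes, but then \<open>x = 2 a\<close> lies in the base field.\<close>
        hence "inverse x = inverse (2 * a) + 0 * r" using x(1) by simp
        moreover have "inverse (2 * a) \<in> adjoin H" by (intro adjoin_intros x)
        ultimately show ?thesis using adjoin_0[of H] by blast
      next
        case False
        define N where "N = a\<^sup>2 - b\<^sup>2 * r\<^sup>2"
        have N: "N = x * (a - b * r)" by (simp add: N_def x power2_eq_square algebra_simps)
        have "N \<noteq> 0" using False inverse by (simp add: N)
        hence "inverse x = (a - b * r) / N" using False inverse by (simp add: N divide_simps)
        hence "inverse x = a / N + (- b / N) * r" by (simp add: diff_divide_distrib)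
        moreover have "N \<in> adjoin H" unfolding N_def by (intro adjoin_intros x r)
        ultimately show ?thesis
          using SI[of "a / N" "- b / N"] x by (simp add: adjoin_intros)
      qed
    next
      case (add x y)
      then obtain a b a' b' where "x = a + b * r" "a \<in> adjoin H" "b \<in> adjoin H"
        "y = a' + b' * r" "a' \<in> adjoin H" "b' \<in> adjoin H" by blast
      thus ?case using SI[of "a + a'" "b + b'"] by (simp add: adjoin_intros algebra_simps)
    next
      case (mult x y)
      then obtain a b a' b' where "x = a + b * r" "a \<in> adjoin H" "b \<in> adjoin H"
        "y = a' + b' * r" "a' \<in> adjoin H" "b' \<in> adjoin H" by blast
      moreover from this have "x * y = (a * a' + b * b' * r\<^sup>2) + (a * b' + b * a') * r"
        by (simp add: algebra_simps power2_eq_square)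
      ultimately show ?case
        using SI[of "a * a' + b * b' * r\<^sup>2" "a * b' + b * a'"] r by (simp add: adjoin_intros)
    qed
  qed
next
  show "?S \<subseteq> adjoin (insert r H)"
  proof safe
    fix a b assume "a \<in> adjoin H" "b \<in> adjoin H"
    hence "a \<in> adjoin (insert r H)" "b \<in> adjoin (insert r H)" "r \<in> adjoin (insert r H)"
      using adjoin_mono[of H "insert r H"] by (auto intro: adjoin_gen)
    thus "a + b * r \<in> adjoin (insert r H)" by (intro adjoin_intros)
  qed
qed

lemma adjoin_sqrt_coeffs_unique:
  assumes "r \<notin> adjoin H"
    and "a \<in> adjoin H" "b \<in> adjoin H" "a' \<in> adjoin H" "b' \<in> adjoin H"
    and "a + b * r = a' + b' * r"
  shows "a = a'" "b = b'"
proof -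
  show "b = b'"
  proof (rule ccontr)
    assume "b \<noteq> b'"
    hence "r = (a' - a) / (b - b')" using assms(6) by (simp add: field_simps)
    also have "\<dots> \<in> adjoin H" by (intro adjoin_intros assms)
    finally show False using assms(1) by simp
  qed
  thus "a = a'" using assms(6) by simp
qed

text \<open>An endomorphism is only constrained on the field generated by \<open>H\<close>; its values elsewhere are arbitrary.\<close>

locale field_endo =
  fixes H :: "complex set" and \<sigma> :: "complex \<Rightarrow> complex"
  assumes closed: "x \<in> adjoin H \<Longrightarrow> \<sigma> x \<in> adjoin H"
    and map_1: "\<sigma> 1 = 1"
    and map_add: "x \<in> adjoin H \<Longrightarrow> y \<in> adjoin H \<Longrightarrow> \<sigma> (x + y) = \<sigma> x + \<sigma> y"
    and map_mult: "x \<in> adjoin H \<Longrightarrow> y \<in> adjoin H \<Longrightarrow> \<sigma> (x * y) = \<sigma> x * \<sigma> y"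
begin

lemma map_0: "\<sigma> 0 = 0"
  using map_add[of 0 0] by (simp add: adjoin_intros)

lemma map_uminus: "x \<in> adjoin H \<Longrightarrow> \<sigma> (- x) = - \<sigma> x"
  using map_add[of x "- x"] map_0 by (simp add: adjoin_intros minus_unique)

lemma map_inverse:
  assumes "x \<in> adjoin H"
  shows "\<sigma> (inverse x) = inverse (\<sigma> x)"
proof (cases "x = 0")
  case False
  hence "\<sigma> (inverse x) * \<sigma> x = 1"
    using map_mult[of "inverse x" x] assms map_1 by (simp add: adjoin_intros)
  thus ?thesis by (metis inverse_unique inverse_inverse_eq)
qed (simp add: map_0)

lemma map_divide: "x \<in> adjoin H \<Longrightarrow> y \<in> adjoin H \<Longrightarrow> \<sigma> (x / y) = \<sigma> x / \<sigma> y"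
  by (simp add: divide_inverse map_mult map_inverse adjoin_intros)

lemma map_power: "x \<in> adjoin H \<Longrightarrow> \<sigma> (x ^ n) = \<sigma> x ^ n"
  by (induction n) (simp_all add: map_1 map_mult adjoin_intros)

lemma map_of_nat: "\<sigma> (of_nat n) = of_nat n"
  by (induction n) (simp_all add: map_0 map_1 map_add adjoin_intros)

lemma map_of_int: "\<sigma> (of_int n) = of_int n"
  by (cases n rule: int_cases2) (simp_all add: map_of_nat map_uminus adjoin_intros)

lemma map_numeral: "\<sigma> (numeral n) = numeral n"
  using map_of_nat[of "numeral n"] by simp

lemma map_sum: "(\<And>i. i \<in> I \<Longrightarrow> f i \<in> adjoin H) \<Longrightarrow> \<sigma> (\<Sum>i\<in>I. f i) = (\<Sum>i\<in>I. \<sigma> (f i))"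
  by (induction I rule: infinite_finite_induct) (simp_all add: map_0 map_add adjoin_intros)

lemma map_prod: "(\<And>i. i \<in> I \<Longrightarrow> f i \<in> adjoin H) \<Longrightarrow> \<sigma> (\<Prod>i\<in>I. f i) = (\<Prod>i\<in>I. \<sigma> (f i))"
  by (induction I rule: infinite_finite_induct) (simp_all add: map_1 map_mult adjoin_intros)

lemma map_algebraic_int:
  assumes "x \<in> adjoin H" "algebraic_int x"
  shows "algebraic_int (\<sigma> x)"
proof -
  from assms(2) obtain p where p: "poly (map_poly of_int p) x = 0" "Polynomial.lead_coeff p = 1"
    unfolding algebraic_int_altdef_ipoly by auto
  have "Polynomial.degree (map_poly complex_of_int p) = Polynomial.degree p"
    by (simp add: degree_map_poly)
  hence eval: "poly (map_poly of_int p) y =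
      (\<Sum>i\<le>Polynomial.degree p. of_int (Polynomial.coeff p i) * y ^ i)" for y :: complex
    unfolding poly_altdef by (simp add: coeff_map_poly)
  have "\<sigma> (poly (map_poly of_int p) x) = poly (map_poly of_int p) (\<sigma> x)"
    unfolding eval using assms(1)
    by (simp add: map_sum map_mult map_of_int map_power adjoin_intros)
  hence "poly (map_poly of_int p) (\<sigma> x) = 0" using p(1) map_0 by simp
  thus ?thesis using p(2) unfolding algebraic_int_altdef_ipoly by auto
qed

end

lemma field_endo_eqI:
  assumes "field_endo H \<sigma>" "field_endo H \<tau>" and "\<And>h. h \<in> H \<Longrightarrow> \<sigma> h = \<tau> h" and "x \<in> adjoin H"
  shows "\<sigma> x = \<tau> x"
proof -
  interpret s: field_endo H \<sigma> by fact
  interpret t: field_endo H \<tau> by fact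
  from \<open>x \<in> adjoin H\<close> show ?thesis
    by (induction rule: adjoin_induct)
      (simp_all add: assms(3) s.map_1 t.map_1 s.map_uminus t.map_uminus s.map_inverse t.map_inverse
        s.map_add t.map_add s.map_mult t.map_mult)
qed

lemma field_endo_id: "field_endo H id"
  by unfold_locales auto

lemma field_endo_comp:
  assumes "field_endo H \<sigma>" "field_endo H \<tau>"
  shows "field_endo H (\<sigma> \<circ> \<tau>)"
proof -
  interpret s: field_endo H \<sigma> by fact
  interpret t: field_endo H \<tau> by fact
  show ?thesis
    by unfold_locales (simp_all add: s.closed t.closed s.map_1 t.map_1 s.map_add t.map_add s.map_mult t.map_mult)
qed

lemma Gal_imp_field_endo:
  assumes "\<sigma> \<in> Gal (adjoin H)"
  shows "field_endo H \<sigma>"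
  using assms by unfold_locales (auto simp: Gal_def ring_iso_def Ring.ring_hom_def)

text \<open>If the square root \<open>r\<close> is not in the base field, then \<open>a + b r \<mapsto> a - b r\<close> is well defined on the quadratic
extension. It is bijective because it is its own inverse.\<close>

lemma quadratic_conjugation_exists:
  assumes sq: "r\<^sup>2 \<in> adjoin H" and r: "r \<notin> adjoin H"
  shows "\<exists>\<sigma> \<in> Gal (adjoin (insert r H)). \<sigma> r = - r \<and> (\<forall>x\<in>adjoin H. \<sigma> x = x)"
proof -
  let ?K = "adjoin (insert r H)"
  define \<sigma> where "\<sigma> = (\<lambda>x\<in>?K. THE y. \<exists>a b. a \<in> adjoin H \<and> b \<in> adjoin H \<and> x = a + b * r \<and> y = a - b * r)"
  have mem: "a + b * r \<in> ?K" "a - b * r \<in> ?K" if "a \<in> adjoin H" "b \<in> adjoin H" for a b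
  proof -
    have "a \<in> ?K" "b \<in> ?K" using that adjoin_mono[of H "insert r H"] by auto
    moreover have "r \<in> ?K" by (simp add: adjoin_gen)
    ultimately show "a + b * r \<in> ?K" "a - b * r \<in> ?K" by (auto intro!: adjoin_intros)
  qed
  have \<sigma>: "\<sigma> (a + b * r) = a - b * r" if "a \<in> adjoin H" "b \<in> adjoin H" for a b
  proof -
    have "(THE y. \<exists>a' b'. a' \<in> adjoin H \<and> b' \<in> adjoin H \<and> a + b * r = a' + b' * r \<and> y = a' - b' * r)
        = a - b * r"
      by (rule the_equality) (use that adjoin_sqrt_coeffs_unique[OF r] in blast)+
    thus ?thesis using mem[OF that] by (simp add: \<sigma>_def)
  qed
  have \<sigma>': "\<sigma> (a - b * r) = a + b * r" if "a \<in> adjoin H" "b \<in> adjoin H" for a b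
    using \<sigma>[of a "-b"] that by (simp add: adjoin_intros)
  have K: "\<exists>a b. a \<in> adjoin H \<and> b \<in> adjoin H \<and> x = a + b * r" if "x \<in> ?K" for x
    using that adjoin_insert_sqrt[OF sq] by blast
  have inv: "\<sigma> x \<in> ?K" "\<sigma> (\<sigma> x) = x" if "x \<in> ?K" for x
    using K[OF that] \<sigma> \<sigma>' mem by auto
  have "bij_betw \<sigma> ?K ?K"
    by (rule bij_betw_byWitness[of _ \<sigma>]) (use inv in auto)
  moreover have "\<sigma> (x + y) = \<sigma> x + \<sigma> y" "\<sigma> (x * y) = \<sigma> x * \<sigma> y" if xy: "x \<in> ?K" "y \<in> ?K" for x y
  proof -
    obtain a b a' b' where *: "x = a + b * r" "a \<in> adjoin H" "b \<in> adjoin H"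
        "y = a' + b' * r" "a' \<in> adjoin H" "b' \<in> adjoin H" using xy K by metis
    have sxy: "\<sigma> x = a - b * r" "\<sigma> y = a' - b' * r" using \<sigma> * by auto
    have "x + y = (a + a') + (b + b') * r" using * by (simp add: algebra_simps)
    moreover have "\<sigma> ((a + a') + (b + b') * r) = (a + a') - (b + b') * r"
      by (intro \<sigma> adjoin_intros *)
    ultimately have "\<sigma> (x + y) = (a + a') - (b + b') * r" by (simp only:)
    thus "\<sigma> (x + y) = \<sigma> x + \<sigma> y" unfolding sxy by (simp add: algebra_simps)
    have "x * y = (a * a' + b * b' * r\<^sup>2) + (a * b' + b * a') * r"
      using * by (simp add: algebra_simps power2_eq_square)
    moreover have "\<sigma> ((a * a' + b * b' * r\<^sup>2) + (a * b' + b * a') * r)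
      = (a * a' + b * b' * r\<^sup>2) - (a * b' + b * a') * r"
      by (intro \<sigma> adjoin_intros * sq)
    ultimately have "\<sigma> (x * y) = (a * a' + b * b' * r\<^sup>2) - (a * b' + b * a') * r"
      by (simp only:)
    thus "\<sigma> (x * y) = \<sigma> x * \<sigma> y"
      unfolding sxy by (simp add: algebra_simps power2_eq_square)
  qed
  moreover have base: "\<sigma> x = x" if "x \<in> adjoin H" for x
    using \<sigma>[of x 0] that by (simp add: adjoin_intros)
  moreover have "\<sigma> 1 = 1" by (rule base) (rule adjoin_1)
  moreover have "\<sigma> r = - r" using \<sigma>[of 0 1] by (simp add: adjoin_intros)
  moreover have "\<sigma> \<in> extensional ?K" by (simp add: \<sigma>_def)
  ultimately have "\<sigma> \<in> Gal ?K"
    using inv(1) by (auto simp: Gal_def ring_iso_def Ring.ring_hom_def)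
  thus ?thesis using base \<open>\<sigma> r = - r\<close> by blast
qed

section \<open>Independence of square roots\<close>

text \<open>If \<open>r j\<close> were in the field, it would be a rational multiple of the product of some other \<open>r i\<close>, and multiplying by
that product would give a rational product of distinct roots.\<close>

lemma sqrt_notin_if_rational_squares_monomial:
  assumes "finite A" "j \<notin> A" "\<And>i. i \<in> insert j A \<Longrightarrow> (r i)\<^sup>2 \<in> \<rat>"
    and irr: "\<And>S. S \<subseteq> insert j A \<Longrightarrow> S \<noteq> {} \<Longrightarrow> (\<Prod>i\<in>S. r i) \<notin> \<rat>"
    and monomial: "\<And>x. x \<in> adjoin (r ` A) \<Longrightarrow> x\<^sup>2 \<in> \<rat> \<Longrightarrow>
      \<exists>c\<in>\<rat>. \<exists>S\<subseteq>A. x = c * (\<Prod>i\<in>S. r i)"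
  shows "r j \<notin> adjoin (r ` A)"
proof
  assume "r j \<in> adjoin (r ` A)"
  then obtain c S where cS: "c \<in> \<rat>" "S \<subseteq> A" "r j = c * (\<Prod>i\<in>S. r i)"
    using monomial[of "r j"] assms(3)[of j] by blast
  have fin: "finite S" "j \<notin> S" using cS assms by (auto intro: finite_subset)
  have "(\<Prod>i\<in>insert j S. r i) = c * (\<Prod>i\<in>S. (r i)\<^sup>2)"
    using fin cS(3) by (simp add: power2_eq_square prod.distrib)
  also have "\<dots> \<in> \<rat>"
    by (intro Rats_mult Rats_prod cS(1) assms(3)) (use cS(2) in blast)
  finally show False using irr[of "insert j S"] cS by auto
qed

text \<open>Induction over the roots: if \<open>x = a + b r\<close> has a rational square, then \<open>2 a b\<close> has to vanish, and so \<open>x = a\<close> or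
\<open>x = b r\<close>, where \<open>a\<close> and \<open>b\<close> also have rational squares.\<close>

lemma rational_square_in_multiquadratic_field:
  assumes "finite A" "\<And>i. i \<in> A \<Longrightarrow> (r i)\<^sup>2 \<in> \<rat>"
    and "\<And>S. S \<subseteq> A \<Longrightarrow> S \<noteq> {} \<Longrightarrow> (\<Prod>i\<in>S. r i) \<notin> \<rat>"
    and "x \<in> adjoin (r ` A)" "x\<^sup>2 \<in> \<rat>"
  shows "\<exists>c\<in>\<rat>. \<exists>S\<subseteq>A. x = c * (\<Prod>i\<in>S. r i)"
  using assms
proof (induction A arbitrary: x rule: finite_induct)
  case empty
  thus ?case by (auto simp: adjoin_empty intro!: bexI[of _ x])
next
  case (insert j A)
  have irr: "(\<Prod>i\<in>S. r i) \<notin> \<rat>" if "S \<subseteq> A" "S \<noteq> {}" for S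
    using insert.prems(2)[of S] that by auto
  have IH: "\<exists>c\<in>\<rat>. \<exists>S\<subseteq>A. y = c * (\<Prod>i\<in>S. r i)"
    if "y \<in> adjoin (r ` A)" "y\<^sup>2 \<in> \<rat>" for y
    using insert.IH[of y] insert.prems(1) irr that by blast
  have rj: "r j \<notin> adjoin (r ` A)"
    by (rule sqrt_notin_if_rational_squares_monomial[OF insert.hyps insert.prems(1,2) IH])
  have sq: "(r j)\<^sup>2 \<in> adjoin (r ` A)" using insert.prems(1) by (auto intro: adjoin_Rats)
  obtain a b where ab: "x = a + b * r j" "a \<in> adjoin (r ` A)" "b \<in> adjoin (r ` A)"
    using insert.prems(3) adjoin_insert_sqrt[OF sq] by auto
  \<comment> \<open>As \<open>x\<^sup>2\<close> lies in the base field, its coefficient \<open>2 a b\<close> at \<open>r j\<close> vanishes.\<close>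
  have "a\<^sup>2 + b\<^sup>2 * (r j)\<^sup>2 + 2 * a * b * r j = x\<^sup>2 + 0 * r j"
    unfolding ab(1) by (simp add: power2_eq_square algebra_simps)
  moreover have "x\<^sup>2 \<in> adjoin (r ` A)" using insert.prems(4) by (rule adjoin_Rats)
  moreover have "a\<^sup>2 + b\<^sup>2 * (r j)\<^sup>2 \<in> adjoin (r ` A)"
    by (intro adjoin_add adjoin_mult sq adjoin_power ab)
  moreover have "2 * a * b \<in> adjoin (r ` A)"
    by (intro adjoin_mult adjoin_numeral ab)
  ultimately have "2 * a * b = 0"
    using adjoin_sqrt_coeffs_unique(2)[OF rj _ _ _ adjoin_0] by blast
  hence "b = 0 \<or> a = 0" by auto
  thus ?case
  proof
    assume "b = 0"
    hence "\<exists>c\<in>\<rat>. \<exists>S\<subseteq>A. x = c * (\<Prod>i\<in>S. r i)"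
      using ab insert.prems(1,4) irr by (intro insert.IH) auto
    thus ?thesis by blast
  next
    assume "a = 0"
    hence x: "x = b * r j" using ab by simp
    have "r j \<noteq> 0" using rj adjoin_0 by auto
    hence "b\<^sup>2 = x\<^sup>2 / (r j)\<^sup>2" by (simp add: x field_simps)
    hence "b\<^sup>2 \<in> \<rat>" using insert.prems(1,4) by auto
    hence "\<exists>c\<in>\<rat>. \<exists>S\<subseteq>A. b = c * (\<Prod>i\<in>S. r i)"
      using ab insert.prems(1,4) irr by (intro insert.IH) auto
    then obtain c S where cS: "c \<in> \<rat>" "S \<subseteq> A" "b = c * (\<Prod>i\<in>S. r i)" by blast
    have "finite S" "j \<notin> S" using cS insert.hyps by (auto intro: finite_subset)
    hence "x = c * (\<Prod>i\<in>insert j S. r i)" using cS x by simp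
    thus ?thesis using cS by blast
  qed
qed

lemma sqrt_notin_multiquadratic_field:
  assumes "finite A" "j \<notin> A" "\<And>i. i \<in> insert j A \<Longrightarrow> (r i)\<^sup>2 \<in> \<rat>"
    and irr: "\<And>S. S \<subseteq> insert j A \<Longrightarrow> S \<noteq> {} \<Longrightarrow> (\<Prod>i\<in>S. r i) \<notin> \<rat>"
  shows "r j \<notin> adjoin (r ` A)"
proof (rule sqrt_notin_if_rational_squares_monomial[OF assms])
  have "(\<Prod>i\<in>S. r i) \<notin> \<rat>" if "S \<subseteq> A" "S \<noteq> {}" for S
    using irr[of S] that by auto
  thus "\<exists>c\<in>\<rat>. \<exists>S\<subseteq>A. x = c * (\<Prod>i\<in>S. r i)"
    if "x \<in> adjoin (r ` A)" "x\<^sup>2 \<in> \<rat>" for x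
    using rational_square_in_multiquadratic_field[OF assms(1) _ _ that] assms(3) by blast
qed

text \<open>The square of the reduced denominator of \<open>x\<close> divides \<open>N\<close>.\<close>

lemma integral_if_square_times_squarefree_integral:
  fixes x :: complex and N :: int
  assumes "x \<in> \<rat>" "squarefree N" "x\<^sup>2 * of_int N \<in> \<int>"
  shows "x \<in> \<int>"
proof -
  from assms(1) obtain a b where ab: "b > 0" "coprime a b" "x = of_int a / of_int b"
    by (auto elim: Rats_cases')
  from assms(3) obtain k where k: "x\<^sup>2 * of_int N = of_int k" by (auto elim: Ints_cases)
  have "complex_of_int (a\<^sup>2 * N) = of_int (b\<^sup>2 * k)"
    using k ab by (simp add: field_simps)
  hence "a\<^sup>2 * N = b\<^sup>2 * k" unfolding of_int_eq_iff .
  hence "b\<^sup>2 dvd a\<^sup>2 * N" by simp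
  moreover have "coprime (b\<^sup>2) (a\<^sup>2)" using ab by (simp add: coprime_commute)
  ultimately have "b\<^sup>2 dvd N" by (simp add: coprime_dvd_mult_right_iff)
  hence "b dvd 1" using assms(2) by (auto simp: squarefree_def)
  hence "b = 1" using ab by auto
  thus ?thesis using ab by simp
qed

section \<open>The Galois action on the genus field\<close>

locale prime_discriminant_roots =
  fixes t u :: nat and q :: "nat \<Rightarrow> int" and r :: "nat \<Rightarrow> complex"
  assumes ut: "u + 2 \<le> t"
    and prime_disc: "\<And>i. i \<in> {1..t} \<Longrightarrow> prime_discriminant (q i)"
    and coprime: "\<And>i j. i \<in> {1..t} \<Longrightarrow> j \<in> {1..t} \<Longrightarrow> i \<noteq> j \<Longrightarrow> coprime (q i) (q j)"
    and q_t: "q t \<in> {-4, -8}"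
    and odd_q: "\<And>i. i \<in> {1..t-1} \<Longrightarrow> odd (q i)"
    and q_pos: "\<And>i. i \<in> {1..u} \<Longrightarrow> q i > 0"
    and q_neg: "\<And>i. i \<in> {u<..t} \<Longrightarrow> q i < 0"
    and r_sq: "\<And>i. i \<in> {1..t} \<Longrightarrow> (r i)\<^sup>2 = of_int (q i)"
begin

text \<open>Dividing \<open>q t\<close> by the square \<open>4\<close> makes all these numbers squarefree; \<open>root_core\<close> is the matching square root, which is
\<open>\<alpha>\<^sub>t\<close> for the last index.\<close>

definition disc_core :: "nat \<Rightarrow> int" where "disc_core i = (if i = t then q t div 4 else q i)"

definition root_core :: "nat \<Rightarrow> complex" where "root_core i = (if i = t then r t / 2 else r i)"

lemma disc_core_t: "disc_core t \<in> {-1, -2}" using q_t by (auto simp: disc_core_def)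

lemma q_odd_prime:
  assumes "i \<in> {1..t-1}"
  shows "\<exists>p. normalization_semidom_class.prime p \<and> odd p \<and> q i = (-1) ^ ((p - 1) div 2) * int p"
proof -
  have "i \<in> {1..t}" using assms by auto
  from prime_disc[OF this] odd_q[OF assms] show ?thesis
    unfolding prime_discriminant_def by (auto simp del: One_nat_def)
qed

lemma abs_q_prime: "i \<in> {1..t-1} \<Longrightarrow> normalization_semidom_class.prime \<bar>q i\<bar>"
  using q_odd_prime[of i] by (auto simp: abs_mult power_abs)

text \<open>This is what makes \<open>(1 \<plusminus> \<surd>q\<^sub>i\<^sup>*) / 2\<close> an algebraic integer.\<close>

lemma q_mod_4:
  assumes "i \<in> {1..t-1}"
  shows "4 dvd 1 - q i"
proof -
  obtain p where p: "odd p" "q i = (-1) ^ ((p - 1) div 2) * int p"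
    using q_odd_prime[OF assms] by blast
  then obtain k where k: "p = 2 * k + 1" by (auto elim: oddE)
  have "q i = (-1) ^ k * (2 * int k + 1)" using p k by simp
  moreover obtain l where "k = 2 * l \<or> k = 2 * l + 1" by (metis evenE oddE)
  ultimately have "1 - q i = 4 * (- int l) \<or> 1 - q i = 4 * (int l + 1)" by auto
  thus ?thesis by (metis dvd_triv_left)
qed

lemma squarefree_disc_core:
  assumes "i \<in> {1..t}"
  shows "squarefree (disc_core i)"
proof (cases "i = t")
  case True
  have "squarefree (2 :: int)" by (intro squarefree_prime) simp
  thus ?thesis using disc_core_t True by auto
next
  case False
  hence "normalization_semidom_class.prime \<bar>q i\<bar>" using abs_q_prime assms by auto
  hence "squarefree \<bar>q i\<bar>" by (rule squarefree_prime)
  thus ?thesis using False by (simp add: disc_core_def squarefree_def)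
qed

lemma coprime_disc_core: "i \<in> {1..t} \<Longrightarrow> j \<in> {1..t} \<Longrightarrow> i \<noteq> j \<Longrightarrow> coprime (disc_core i) (disc_core j)"
proof -
  assume ij: "i \<in> {1..t}" "j \<in> {1..t}" "i \<noteq> j"
  have "disc_core k dvd q k" for k using q_t by (auto simp: disc_core_def)
  thus ?thesis using coprime_divisors coprime[OF ij] by blast
qed

lemma squarefree_prod_disc_core: "S \<subseteq> {1..t} \<Longrightarrow> squarefree (\<Prod>i\<in>S. disc_core i)"
  using squarefree_disc_core coprime_disc_core by (intro squarefree_prod_coprime) blast+

lemma root_core_sq: "i \<in> {1..t} \<Longrightarrow> (root_core i)\<^sup>2 = of_int (disc_core i)"
  using r_sq[of i] q_t by (auto simp: root_core_def disc_core_def power_divide)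

lemma r_nonzero: "i \<in> {1..t} \<Longrightarrow> r i \<noteq> 0"
  using r_sq[of i] q_pos[of i] q_neg[of i] by (cases "i \<le> u") auto

text \<open>Up to a factor \<open>2\<close> the product is a square root of a squarefree integer. If it were rational, this integer would be \<open>1\<close>,
but its factors are primes up to sign, except for the possible factor \<open>-1\<close> when \<open>q t = -4\<close>.\<close>

lemma prod_r_irrational:
  assumes "S \<subseteq> {1..t}" "S \<noteq> {}"
  shows "(\<Prod>i\<in>S. r i) \<notin> \<rat>"
proof
  assume rat: "(\<Prod>i\<in>S. r i) \<in> \<rat>"
  let ?x = "\<Prod>i\<in>S. root_core i" and ?c = "\<Prod>i\<in>S. if i = t then 2 else (1 :: complex)"
  have fin: "finite S" using assms(1) finite_subset by blast
  have "(\<Prod>i\<in>S. r i) = ?x * ?c"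
    unfolding prod.distrib[symmetric] by (intro prod.cong) (auto simp: root_core_def)
  moreover have "?c \<noteq> 0" using fin by simp
  ultimately have "?x = (\<Prod>i\<in>S. r i) / ?c" by (simp add: field_simps)
  moreover have "?c \<in> \<rat>" by (intro Rats_prod) auto
  ultimately have x_rat: "?x \<in> \<rat>" using rat by (metis Rats_divide)
  have x_sq: "?x\<^sup>2 = of_int (\<Prod>i\<in>S. disc_core i)"
    using assms root_core_sq by (auto simp: prod_power_distrib intro!: prod.cong)
  have "?x \<in> \<int>"
    by (rule integral_if_square_times_squarefree_integral[of _ 1]) (use x_rat x_sq in auto)
  then obtain k where "?x = of_int k" by (auto elim: Ints_cases)
  with x_sq have k: "k\<^sup>2 = (\<Prod>i\<in>S. disc_core i)" by (metis of_int_eq_iff of_int_power)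
  hence "k dvd 1" using squarefree_prod_disc_core[OF assms(1)] by (metis dvd_refl squarefree_def)
  hence one: "(\<Prod>i\<in>S. disc_core i) = 1" using k by (auto simp: zdvd1_eq abs_eq_iff')
  have unit: "disc_core i dvd 1" if "i \<in> S" for i
    using dvd_prodI[OF fin that, of disc_core] one by simp
  have "i = t" if "i \<in> S" for i
  proof (rule ccontr)
    assume "i \<noteq> t"
    moreover have "i \<in> {1..t}" using that assms by blast
    ultimately have "i \<in> {1..t-1}" by auto
    hence "normalization_semidom_class.prime \<bar>q i\<bar>" by (rule abs_q_prime)
    moreover have "q i dvd 1" using unit[OF that] \<open>i \<noteq> t\<close> by (simp add: disc_core_def)
    ultimately show False by (simp add: not_prime_unit)
  qed
  hence "S = {t}" using assms(2) by blast
  thus False using one disc_core_t by auto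
qed

lemma r_notin_adjoin_others:
  assumes "j \<in> {1..t}"
  shows "r j \<notin> adjoin (r ` ({1..t} - {j}))"
proof (rule sqrt_notin_multiquadratic_field)
  show "(\<Prod>i\<in>S. r i) \<notin> \<rat>" if "S \<subseteq> insert j ({1..t} - {j})" "S \<noteq> {}" for S
    using that assms by (intro prod_r_irrational) auto
qed (use assms r_sq in auto)

abbreviation gens :: "complex set" where "gens \<equiv> r ` {1..t}"

lemma genus_field_eq: "genus_field t r = adjoin gens"
  by (simp add: genus_field_def adjoin_def)

lemma r_in_K: "i \<in> {1..t} \<Longrightarrow> r i \<in> adjoin gens"
  by (auto intro: adjoin_gen)

text \<open>Conjugation of the quadratic extension \<open>K\<close> over the field generated by the other roots has the required values; it
is determined by them since automorphisms are determined by their values on generators.\<close>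

lemma tau_spec:
  assumes j: "j \<in> {1..t}"
  shows "tau t r j \<in> Gal (adjoin gens) \<and> tau t r j (r j) = - r j \<and>
    (\<forall>i\<in>{1..t}. i \<noteq> j \<longrightarrow> tau t r j (r i) = r i)"
proof -
  let ?P = "\<lambda>\<sigma>. \<sigma> \<in> Gal (adjoin gens) \<and> \<sigma> (r j) = - r j \<and>
    (\<forall>i\<in>{1..t}. i \<noteq> j \<longrightarrow> \<sigma> (r i) = r i)"
  let ?H = "r ` ({1..t} - {j})"
  have gens: "gens = insert (r j) ?H" using j by auto
  have "(r j)\<^sup>2 \<in> adjoin ?H" using r_sq[OF j] by (simp add: adjoin_intros)
  from quadratic_conjugation_exists[OF this r_notin_adjoin_others[OF j]]
  obtain \<sigma> where \<sigma>: "\<sigma> \<in> Gal (adjoin gens)" "\<sigma> (r j) = - r j" "\<forall>x\<in>adjoin ?H. \<sigma> x = x"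
    unfolding gens by blast
  hence "?P \<sigma>" by (auto intro: adjoin_gen)
  moreover have "\<sigma>1 = \<sigma>2" if "?P \<sigma>1" "?P \<sigma>2" for \<sigma>1 \<sigma>2
  proof
    fix x
    have "\<sigma>1 (r i) = \<sigma>2 (r i)" if "i \<in> {1..t}" for i
        using \<open>?P \<sigma>1\<close> \<open>?P \<sigma>2\<close> that by (cases "i = j") metis+
    hence gens_eq: "\<sigma>1 g = \<sigma>2 g" if "g \<in> gens" for g using that by blast
    show "\<sigma>1 x = \<sigma>2 x"
    proof (cases "x \<in> adjoin gens")
      case True
      show ?thesis
        by (rule field_endo_eqI[OF _ _ gens_eq True]) (use that Gal_imp_field_endo in blast)+
    next
      case False
      thus ?thesis using that by (auto simp: Gal_def extensional_def)
    qed
  qed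
  ultimately have "\<exists>!\<sigma>. ?P \<sigma>" by blast
  from theI'[OF this] show ?thesis unfolding tau_def genus_field_eq .
qed

lemma tau_power:
  assumes j: "j \<in> {1..t}"
  shows "field_endo gens (tau t r j ^^ k)"
    and "i \<in> {1..t} \<Longrightarrow> (tau t r j ^^ k) (r i) = (if i = j then (-1) ^ k * r i else r i)"
proof -
  interpret field_endo gens "tau t r j"
    using tau_spec[OF j] by (intro Gal_imp_field_endo) simp
  show "field_endo gens (tau t r j ^^ k)"
  proof (induction k)
    case (Suc k)
    show ?case unfolding funpow.simps(2) by (rule field_endo_comp[OF field_endo_axioms Suc])
  next
    case 0
    show ?case unfolding funpow.simps(1) by (rule field_endo_id)
  qed
  show "(tau t r j ^^ k) (r i) = (if i = j then (-1) ^ k * r i else r i)" if "i \<in> {1..t}"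
  proof (induction k)
    case (Suc k)
    have "tau t r j ((-1) ^ k * r i) = (-1) ^ k * tau t r j (r i)"
      using r_in_K[OF that]
      by (simp add: map_mult map_power map_uminus map_1 adjoin_intros)
    thus ?case using Suc tau_spec[OF j] that by auto
  qed simp
qed

lemma tau_foldr:
  assumes "set js \<subseteq> {1..t}" "distinct js"
  shows "field_endo gens (foldr (\<circ>) (map (\<lambda>j. tau t r j ^^ \<mu> j) js) id) \<and>
    (\<forall>i\<in>{1..t}. foldr (\<circ>) (map (\<lambda>j. tau t r j ^^ \<mu> j) js) id (r i) =
      (if i \<in> set js then (-1) ^ \<mu> i * r i else r i))"
  using assms
proof (induction js)
  case (Cons j js)
  define \<sigma> where "\<sigma> = foldr (\<circ>) (map (\<lambda>j. tau t r j ^^ \<mu> j) js) id"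
  have j: "j \<in> {1..t}" using Cons.prems by simp
  interpret p: field_endo gens "tau t r j ^^ \<mu> j" by (rule tau_power[OF j])
  have IH: "field_endo gens \<sigma>"
    "\<forall>i\<in>{1..t}. \<sigma> (r i) = (if i \<in> set js then (-1) ^ \<mu> i * r i else r i)"
    using Cons.IH Cons.prems unfolding \<sigma>_def distinct.simps list.set by blast+
  have "(tau t r j ^^ \<mu> j) ((-1) ^ k * r i) = (-1) ^ k * (tau t r j ^^ \<mu> j) (r i)"
    if "i \<in> {1..t}" for k i
    using r_in_K[OF that]
    by (simp add: p.map_mult p.map_power p.map_uminus p.map_1 adjoin_intros)
  hence "\<forall>i\<in>{1..t}. ((tau t r j ^^ \<mu> j) \<circ> \<sigma>) (r i) =
      (if i \<in> set (j # js) then (-1) ^ \<mu> i * r i else r i)"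
    using IH(2) Cons.prems(2) tau_power(2)[OF j] by auto
  moreover have "field_endo gens ((tau t r j ^^ \<mu> j) \<circ> \<sigma>)"
    by (rule field_endo_comp[OF p.field_endo_axioms IH(1)])
  moreover have "foldr (\<circ>) (map (\<lambda>j. tau t r j ^^ \<mu> j) (j # js)) id = (tau t r j ^^ \<mu> j) \<circ> \<sigma>"
    by (simp add: \<sigma>_def)
  ultimately show ?case by presburger
qed (simp add: field_endo_id)

lemma tau_prod_endo: "field_endo gens (tau_prod t r \<mu>)"
  and tau_prod_r: "i \<in> {1..t-1} \<Longrightarrow> tau_prod t r \<mu> (r i) = (-1) ^ \<mu> i * r i"
  and tau_prod_r_t: "tau_prod t r \<mu> (r t) = r t"
proof -
  have "set [1..<t] \<subseteq> {1..t}" by auto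
  from tau_foldr[OF this distinct_upt, of \<mu>]
  have *: "field_endo gens (tau_prod t r \<mu>)"
    "\<forall>i\<in>{1..t}. tau_prod t r \<mu> (r i) = (if i \<in> {1..<t} then (-1) ^ \<mu> i * r i else r i)"
    by (simp_all add: tau_prod_def)
  thus "field_endo gens (tau_prod t r \<mu>)" by blast
  show "tau_prod t r \<mu> (r i) = (-1) ^ \<mu> i * r i" if "i \<in> {1..t-1}" using * that ut by auto
  show "tau_prod t r \<mu> (r t) = r t" using * ut by auto
qed

lemma cnj_r_pos: "i \<in> {1..u} \<Longrightarrow> cnj (r i) = r i"
  and cnj_r_neg: "i \<in> {u<..t} \<Longrightarrow> cnj (r i) = - r i"
proof -
  have pm: "cnj (r i) = r i \<or> cnj (r i) = - r i" if "i \<in> {1..t}" for i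
    using r_sq[OF that] by (metis complex_cnj_of_int complex_cnj_power power2_eq_iff)
  show "cnj (r i) = r i" if i: "i \<in> {1..u}"
  proof (rule ccontr)
    assume "cnj (r i) \<noteq> r i"
    hence "cnj (r i) = - r i" using pm[of i] i ut by auto
    hence "r i * cnj (r i) = - (r i)\<^sup>2" by (simp add: power2_eq_square)
    hence "complex_of_real ((cmod (r i))\<^sup>2) = complex_of_real (- real_of_int (q i))"
      using r_sq[of i] i ut by (simp add: complex_norm_square[symmetric])
    hence "(cmod (r i))\<^sup>2 = - real_of_int (q i)" unfolding of_real_eq_iff .
    thus False using q_pos[OF i] zero_le_power2[of "cmod (r i)"] by linarith
  qed
  show "cnj (r i) = - r i" if i: "i \<in> {u<..t}"
  proof (rule ccontr)
    assume "cnj (r i) \<noteq> - r i"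
    hence "cnj (r i) = r i" using pm[of i] i ut by auto
    hence "r i * cnj (r i) = (r i)\<^sup>2" by (simp add: power2_eq_square)
    hence "complex_of_real ((cmod (r i))\<^sup>2) = complex_of_real (real_of_int (q i))"
      using r_sq[of i] i ut by (simp add: complex_norm_square[symmetric])
    hence "(cmod (r i))\<^sup>2 = real_of_int (q i)" unfolding of_real_eq_iff .
    thus False using q_neg[OF i] zero_le_power2[of "cmod (r i)"] by linarith
  qed
qed

end

(* Without this rule the simplifier keeps the index intervals in the form in which they are stated. *)
declare One_nat_def [simp del]

section \<open>Bit vectors as index sets\<close>

lemma finite_bits: "finite (bits k)"
  by (auto simp: bits_def intro: finite_PiE)

lemma bits_01: "w \<in> bits k \<Longrightarrow> i \<in> {1..k} \<Longrightarrow> w i = 0 \<or> w i = 1"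
  by (auto simp: bits_def PiE_iff)

lemma bits_eqI: "w \<in> bits k \<Longrightarrow> v \<in> bits k \<Longrightarrow> (\<And>i. i \<in> {1..k} \<Longrightarrow> w i = v i) \<Longrightarrow> w = v"
  unfolding bits_def by (rule PiE_ext)

lemma bits_upd: "w \<in> bits k \<Longrightarrow> e \<in> {0, 1} \<Longrightarrow> w(Suc k := e) \<in> bits (Suc k)"
  by (auto simp: bits_def PiE_iff extensional_def)

lemma bits_restrict: "w \<in> bits k \<Longrightarrow> restrict (w(Suc k := e)) {1..k} = w"
  by (rule ext) (auto simp: bits_def PiE_iff extensional_def restrict_def)

lemma bits_SucE:
  assumes "s \<in> bits (Suc k)"
  obtains w e where "w \<in> bits k" "e = 0 \<or> e = 1" "s = w(Suc k := e)"
proof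
  show "restrict s {1..k} \<in> bits k" using assms by (auto simp: bits_def PiE_iff)
  show "s (Suc k) = 0 \<or> s (Suc k) = 1" using assms by (auto simp: bits_def PiE_iff)
  show "s = (restrict s {1..k})(Suc k := s (Suc k))"
    using assms by (auto simp: bits_def PiE_iff extensional_def restrict_def fun_eq_iff)
qed

lemma sum_bits_Suc:
  fixes g :: "(nat \<Rightarrow> nat) \<Rightarrow> complex"
  shows "(\<Sum>s\<in>bits (Suc k). g s) = (\<Sum>w\<in>bits k. g (w(Suc k := 0)) + g (w(Suc k := 1)))"
proof -
  have bits: "bits (Suc k) = (\<lambda>(e, w). w(Suc k := e)) ` ({0, 1} \<times> bits k)"
  proof -
    have "{1..Suc k} = insert (Suc k) {1..k}" by auto
    thus ?thesis by (simp only: bits_def PiE_insert_eq)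
  qed
  moreover have "inj_on (\<lambda>(e, w). w(Suc k := e)) ({0, 1 :: nat} \<times> bits k)"
    unfolding bits_def by (rule inj_combinator) simp
  ultimately have "(\<Sum>s\<in>bits (Suc k). g s) = (\<Sum>(e, w)\<in>{0, 1} \<times> bits k. g (w(Suc k := e)))"
    by (simp only: sum.reindex o_def case_prod_unfold)
  also have "\<dots> = (\<Sum>w\<in>bits k. g (w(Suc k := 0)) + g (w(Suc k := 1)))"
    by (subst sum.cartesian_product[symmetric]) (simp add: sum.distrib)
  finally show ?thesis .
qed

section \<open>Bases given as indexed families\<close>

text \<open>The basis is given as an indexed family, so that independence also has to yield that the family is injective.\<close>

lemma is_Z_basis_image:
  assumes fin: "finite I"
    and indep: "\<And>k. (\<Sum>i\<in>I. of_int (k i) * f i) = 0 \<Longrightarrow> \<forall>i\<in>I. k i = 0"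
    and M: "\<And>x. x \<in> M \<longleftrightarrow> (\<exists>k. x = (\<Sum>i\<in>I. of_int (k i) * f i))"
  shows "is_Z_basis (f ` I) M"
proof -
  interpret Z: Modules.module int_scale
    by unfold_locales (simp_all add: algebra_simps)
  have inj: "inj_on f I"
  proof (rule inj_onI, rule ccontr)
    fix i j assume ij: "i \<in> I" "j \<in> I" "f i = f j" "i \<noteq> j"
    let ?k = "\<lambda>l. if l = i then 1 else if l = j then -1 else (0 :: int)"
    have "(\<Sum>l\<in>I. of_int (?k l) * f l) = (\<Sum>l\<in>{i, j}. of_int (?k l) * f l)"
      using fin ij by (intro sum.mono_neutral_right) auto
    also have "\<dots> = 0" using ij by simp
    finally have "?k i = 0" using indep[of ?k] ij(1) by blast
    thus False by simp
  qed
  have sum_image: "(\<Sum>v\<in>f ` I. of_int (k v) * v) = (\<Sum>i\<in>I. of_int (k (f i)) * f i)" for k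
    by (simp add: sum.reindex[OF inj])
  have "\<not> Z.dependent (f ` I)"
  proof
    assume "Z.dependent (f ` I)"
    then obtain k i where k: "i \<in> I" "k (f i) \<noteq> 0" "(\<Sum>v\<in>f ` I. of_int (k v) * v) = 0"
      unfolding Z.dependent_finite[OF finite_imageI[OF fin]] by auto
    from k(3) have "\<forall>i\<in>I. k (f i) = 0" unfolding sum_image by (rule indep)
    thus False using k(1,2) by simp
  qed
  moreover have "Z.span (f ` I) = M"
  proof
    show "Z.span (f ` I) \<subseteq> M"
    proof
      fix x assume "x \<in> Z.span (f ` I)"
      then obtain k where "x = (\<Sum>v\<in>f ` I. of_int (k v) * v)"
        unfolding Z.span_finite[OF finite_imageI[OF fin]] by auto
      thus "x \<in> M" unfolding M sum_image by (rule exI[of _ "\<lambda>i. k (f i)"])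
    qed
    show "M \<subseteq> Z.span (f ` I)"
    proof
      fix x assume "x \<in> M"
      then obtain k where k: "x = (\<Sum>i\<in>I. of_int (k i) * f i)" using M by blast
      have "x = (\<Sum>v\<in>f ` I. of_int (k (the_inv_into I f v)) * v)"
        unfolding sum_image k by (intro sum.cong refl) (simp add: the_inv_into_f_f[OF inj])
      thus "x \<in> Z.span (f ` I)"
        unfolding Z.span_finite[OF finite_imageI[OF fin]] by (rule range_eqI[where x = "\<lambda>v. k (the_inv_into I f v)"])
    qed
  qed
  ultimately show ?thesis by (simp add: is_Z_basis_def)
qed

section \<open>Self-duality of the conjugate products\<close>

context prime_discriminant_roots
begin

definition alpha_bit :: "nat \<Rightarrow> nat \<Rightarrow> complex" where
  "alpha_bit i e = (1 + (if e = 0 then r i else - r i)) / 2"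

text \<open>For \<open>k = t - 1\<close> this is the self-dual family; smaller \<open>k\<close> serve the inductive expansion along the tower of fields.\<close>

definition alpha_prod :: "nat \<Rightarrow> (nat \<Rightarrow> nat) \<Rightarrow> complex" where
  "alpha_prod k w = (\<Prod>i\<in>{1..k}. alpha_bit i (w i))"

definition sgn_bits :: "nat \<Rightarrow> (nat \<Rightarrow> nat) \<Rightarrow> complex" where
  "sgn_bits k w = (-1) ^ (\<Sum>i\<in>{1..k}. w i)"

text \<open>This sum results from expanding the product of the commuting operators \<open>1 - \<tau>\<^sub>i\<close> for \<open>i < t\<close>.\<close>

definition sign_trace :: "complex \<Rightarrow> complex" where
  "sign_trace x = (\<Sum>\<mu>\<in>bits (t-1). sgn_bits (t-1) \<mu> * tau_prod t r \<mu> x)"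

abbreviation root_prod :: complex where "root_prod \<equiv> \<Prod>i\<in>{1..t-1}. r i"

lemma alpha_prod_Suc: "alpha_prod (Suc k) (w(Suc k := e)) = alpha_prod k w * alpha_bit (Suc k) e"
  by (simp add: alpha_prod_def mult.commute)

lemma sgn_bits_Suc: "sgn_bits (Suc k) (w(Suc k := e)) = (-1) ^ e * sgn_bits k w"
  by (simp add: sgn_bits_def power_add mult.commute)

lemma sgn_bits_sq: "sgn_bits k w * sgn_bits k w = 1"
  by (simp add: sgn_bits_def flip: power_mult_distrib)

lemma algebraic_int_sgn_bits: "algebraic_int (sgn_bits k w)"
proof -
  have "sgn_bits k w = of_int ((-1) ^ (\<Sum>i\<in>{1..k}. w i))" by (simp add: sgn_bits_def)
  thus ?thesis by (simp only: algebraic_int_of_int)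
qed

lemma alpha_bit_in_K: "i \<in> {1..t} \<Longrightarrow> alpha_bit i e \<in> adjoin gens"
  by (auto simp: alpha_bit_def intro!: adjoin_intros r_in_K)

lemma alpha_prod_in_K: "k \<le> t \<Longrightarrow> alpha_prod k w \<in> adjoin gens"
  unfolding alpha_prod_def by (intro adjoin_prod alpha_bit_in_K) auto

lemma tau_prod_alpha_bit:
  assumes "i \<in> {1..t-1}" "m \<in> {0, 1}" "\<mu> i = m" "e \<in> {0, 1}"
  shows "tau_prod t r \<mu> (alpha_bit i e) = alpha_bit i (if m = 0 then e else 1 - e)"
proof -
  interpret p: field_endo gens "tau_prod t r \<mu>" by (rule tau_prod_endo)
  have i: "r i \<in> adjoin gens" using assms by (intro r_in_K) auto
  have "tau_prod t r \<mu> (alpha_bit i e) = (1 + (if e = 0 then tau_prod t r \<mu> (r i) else - tau_prod t r \<mu> (r i))) / 2"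
    unfolding alpha_bit_def using i
    by (simp add: p.map_divide p.map_add p.map_uminus p.map_numeral p.map_1 adjoin_intros)
  thus ?thesis using assms tau_prod_r[OF assms(1), of \<mu>] by (auto simp: alpha_bit_def)
qed

lemma adjoin_last_subset: "x \<in> adjoin {r t} \<Longrightarrow> x \<in> adjoin gens"
proof -
  have "{r t} \<subseteq> gens" using ut by auto
  thus "x \<in> adjoin {r t} \<Longrightarrow> x \<in> adjoin gens" using adjoin_mono by blast
qed

lemma tau_prod_fixes_last:
  assumes "x \<in> adjoin {r t}"
  shows "tau_prod t r \<mu> x = x"
proof -
  interpret p: field_endo gens "tau_prod t r \<mu>" by (rule tau_prod_endo)
  from assms show ?thesis
  proof (induction rule: adjoin_induct)
    case (gen x)
    thus ?case using tau_prod_r_t by simp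
  qed (simp_all only: adjoin_last_subset p.map_1 p.map_uminus p.map_inverse p.map_add p.map_mult)
qed

lemma sign_trace_sum:
  assumes "\<And>i. i \<in> I \<Longrightarrow> f i \<in> adjoin gens"
  shows "sign_trace (\<Sum>i\<in>I. f i) = (\<Sum>i\<in>I. sign_trace (f i))"
proof -
  have "sign_trace (\<Sum>i\<in>I. f i) = (\<Sum>\<mu>\<in>bits (t-1). \<Sum>i\<in>I. sgn_bits (t-1) \<mu> * tau_prod t r \<mu> (f i))"
    unfolding sign_trace_def
    by (intro sum.cong refl) (simp only: field_endo.map_sum[OF tau_prod_endo assms] sum_distrib_left)
  also have "\<dots> = (\<Sum>i\<in>I. sign_trace (f i))" unfolding sign_trace_def by (rule sum.swap)
  finally show ?thesis .
qed

lemma sign_trace_algebraic_int: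
  assumes "x \<in> adjoin gens" "algebraic_int x"
  shows "algebraic_int (sign_trace x)"
  unfolding sign_trace_def
  by (intro algebraic_int_sum algebraic_int_add_mult algebraic_int_sgn_bits
      field_endo.map_algebraic_int[OF tau_prod_endo] assms)

text \<open>On a product of factors, each in one \<open>\<rat>(\<surd>q\<^sub>i\<^sup>*)\<close>, the signed trace acts factor by factor. The factor at \<open>i\<close> is \<open>\<alpha>\<^sub>i\<^sup>2\<close> or
\<open>(1 - \<alpha>\<^sub>i)\<^sup>2\<close> if the bits agree, contributing \<open>\<plusminus>\<surd>q\<^sub>i\<^sup>*\<close>, and otherwise \<open>\<alpha>\<^sub>i (1 - \<alpha>\<^sub>i)\<close>, which contributes \<open>0\<close>.\<close>

lemma sign_trace_dual:
  assumes w: "w \<in> bits (t-1)" and v: "v \<in> bits (t-1)" and g: "g \<in> adjoin {r t}"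
  shows "sign_trace (g * (alpha_prod (t-1) w * alpha_prod (t-1) v)) = (if w = v then g * sgn_bits (t-1) w * root_prod else 0)"
proof -
  let ?n = "t - 1"
  define F where "F i m = alpha_bit i (if m = 0 then w i else 1 - w i) * alpha_bit i (if m = 0 then v i else 1 - v i)"
    for i and m :: nat
  have gK: "g \<in> adjoin gens" using g by (rule adjoin_last_subset)
  have tau: "tau_prod t r \<mu> (g * (alpha_prod ?n w * alpha_prod ?n v)) = g * (\<Prod>i\<in>{1..?n}. F i (\<mu> i))" if \<mu>: "\<mu> \<in> bits ?n" for \<mu>
  proof -
    interpret p: field_endo gens "tau_prod t r \<mu>" by (rule tau_prod_endo)
    have alpha_prod: "tau_prod t r \<mu> (alpha_prod ?n z) = (\<Prod>i\<in>{1..?n}. alpha_bit i (if \<mu> i = 0 then z i else 1 - z i))"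
      if "z \<in> bits ?n" for z
    proof -
      have "tau_prod t r \<mu> (alpha_prod ?n z) = (\<Prod>i\<in>{1..?n}. tau_prod t r \<mu> (alpha_bit i (z i)))"
        unfolding alpha_prod_def by (intro p.map_prod alpha_bit_in_K) auto
      also have "\<dots> = (\<Prod>i\<in>{1..?n}. alpha_bit i (if \<mu> i = 0 then z i else 1 - z i))"
        using bits_01[OF \<mu>] bits_01[OF that] by (intro prod.cong refl tau_prod_alpha_bit) auto
      finally show ?thesis .
    qed
    have EK: "alpha_prod ?n z \<in> adjoin gens" for z by (intro alpha_prod_in_K) simp
    have "tau_prod t r \<mu> (g * (alpha_prod ?n w * alpha_prod ?n v)) = g * (tau_prod t r \<mu> (alpha_prod ?n w) * tau_prod t r \<mu> (alpha_prod ?n v))"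
      using tau_prod_fixes_last[OF g] gK EK by (simp add: p.map_mult adjoin_intros)
    thus ?thesis by (simp add: alpha_prod[OF w] alpha_prod[OF v] F_def prod.distrib)
  qed
  have diff: "F i 0 - F i 1 = (if w i = v i then (-1) ^ w i * r i else 0)" if i: "i \<in> {1..?n}" for i
    using bits_01[OF w i] bits_01[OF v i] by (auto simp: F_def alpha_bit_def field_simps)
  have "sign_trace (g * (alpha_prod ?n w * alpha_prod ?n v)) = (\<Sum>\<mu>\<in>bits ?n. g * (\<Prod>i\<in>{1..?n}. (-1) ^ \<mu> i * F i (\<mu> i)))"
    unfolding sign_trace_def using tau
    by (intro sum.cong refl) (simp add: sgn_bits_def power_sum prod.distrib)
  also have "\<dots> = g * (\<Prod>i\<in>{1..?n}. \<Sum>m\<in>{0,1}. (-1) ^ m * F i m)"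
    unfolding bits_def sum_distrib_left[symmetric] by (subst prod_sum_PiE) auto
  also have "\<dots> = g * (\<Prod>i\<in>{1..?n}. if w i = v i then (-1) ^ w i * r i else 0)"
    by (intro arg_cong2[of _ _ _ _ "(*)"] prod.cong refl) (use diff in simp)
  also have "\<dots> = (if w = v then g * sgn_bits ?n w * root_prod else 0)"
  proof (cases "w = v")
    case True
    thus ?thesis by (simp add: sgn_bits_def power_sum prod.distrib)
  next
    case False
    then obtain i where "i \<in> {1..?n}" "w i \<noteq> v i" using bits_eqI[OF w v] by blast
    hence "(\<Prod>i\<in>{1..?n}. if w i = v i then (-1) ^ w i * r i else 0) = 0"
      by (intro prod_zero) auto
    thus ?thesis using False by simp
  qed
  finally show ?thesis .
qed

text \<open>Duality turns the signed trace into a coefficient extractor.\<close>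

lemma sign_trace_coefficient:
  assumes v: "v \<in> bits (t-1)" and y: "\<And>w. w \<in> bits (t-1) \<Longrightarrow> y w \<in> adjoin {r t}"
  shows "sign_trace ((\<Sum>w\<in>bits (t-1). y w * alpha_prod (t-1) w) * alpha_prod (t-1) v) = y v * sgn_bits (t-1) v * root_prod"
proof -
  let ?n = "t - 1"
  have yK: "y w \<in> adjoin gens" if "w \<in> bits ?n" for w
    by (rule adjoin_last_subset) (rule y[OF that])
  have EK: "alpha_prod ?n z \<in> adjoin gens" for z by (intro alpha_prod_in_K) simp
  have "sign_trace ((\<Sum>w\<in>bits ?n. y w * alpha_prod ?n w) * alpha_prod ?n v) = sign_trace (\<Sum>w\<in>bits ?n. y w * (alpha_prod ?n w * alpha_prod ?n v))"
    by (simp add: sum_distrib_right mult.assoc)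
  also have "\<dots> = (\<Sum>w\<in>bits ?n. sign_trace (y w * (alpha_prod ?n w * alpha_prod ?n v)))"
    by (intro sign_trace_sum adjoin_mult yK EK)
  also have "\<dots> = (\<Sum>w\<in>bits ?n. if w = v then y w * sgn_bits ?n w * root_prod else 0)"
    by (intro sum.cong refl sign_trace_dual v y)
  also have "\<dots> = y v * sgn_bits ?n v * root_prod" using v finite_bits by (simp add: sum.delta)
  finally show ?thesis .
qed

lemma root_prod_nonzero: "root_prod \<noteq> 0"
proof -
  have "r i \<noteq> 0" if "i \<in> {1..t-1}" for i using that by (intro r_nonzero) auto
  thus ?thesis by (simp add: prod_zero_iff)
qed

lemma alpha_prod_coefficients_unique:
  assumes "\<And>w. w \<in> bits (t-1) \<Longrightarrow> y w \<in> adjoin {r t}" "\<And>w. w \<in> bits (t-1) \<Longrightarrow> y' w \<in> adjoin {r t}"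
    and eq: "(\<Sum>w\<in>bits (t-1). y w * alpha_prod (t-1) w) = (\<Sum>w\<in>bits (t-1). y' w * alpha_prod (t-1) w)"
    and v: "v \<in> bits (t-1)"
  shows "y v = y' v"
proof -
  have "y v * sgn_bits (t-1) v * root_prod = sign_trace ((\<Sum>w\<in>bits (t-1). y w * alpha_prod (t-1) w) * alpha_prod (t-1) v)"
    by (rule sign_trace_coefficient[OF v assms(1), symmetric])
  also have "\<dots> = y' v * sgn_bits (t-1) v * root_prod"
    unfolding eq by (rule sign_trace_coefficient[OF v assms(2)])
  finally have "y v * sgn_bits (t-1) v * root_prod = y' v * sgn_bits (t-1) v * root_prod" .
  moreover have "sgn_bits (t-1) v \<noteq> 0" by (simp add: sgn_bits_def)
  ultimately show ?thesis using root_prod_nonzero by simp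
qed

text \<open>Induction along the tower of the roots: adjoining one more root doubles the index set, because the two conjugate factors
\<open>\<alpha>\<^sub>i\<close> and \<open>1 - \<alpha>\<^sub>i\<close> span the same space as \<open>1\<close> and \<open>\<surd>q\<^sub>i\<^sup>*\<close>.\<close>

lemma alpha_prod_expansion:
  assumes "k \<le> t - 1" "x \<in> adjoin (insert (r t) (r ` {1..k}))"
  shows "\<exists>y. (\<forall>w\<in>bits k. y w \<in> adjoin {r t}) \<and> x = (\<Sum>w\<in>bits k. y w * alpha_prod k w)"
  using assms
proof (induction k arbitrary: x)
  case 0
  thus ?case by (intro exI[of _ "\<lambda>_. x"]) (simp add: bits_def alpha_prod_def)
next
  case (Suc k)
  let ?L = "adjoin (insert (r t) (r ` {1..k}))"
  have "insert (r t) (r ` {1..Suc k}) = insert (r (Suc k)) (insert (r t) (r ` {1..k}))"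
    by (auto simp: atLeastAtMostSuc_conv)
  moreover have sq: "(r (Suc k))\<^sup>2 \<in> ?L" using r_sq[of "Suc k"] Suc.prems(1) by (simp add: adjoin_intros)
  ultimately obtain a b where ab: "x = a + b * r (Suc k)" "a \<in> ?L" "b \<in> ?L"
    using Suc.prems(2) adjoin_insert_sqrt[OF sq] by auto
  have k: "k \<le> t - 1" using Suc.prems by simp
  from Suc.IH[OF k ab(2)] obtain y where y: "\<And>w. w \<in> bits k \<Longrightarrow> y w \<in> adjoin {r t}"
    "a = (\<Sum>w\<in>bits k. y w * alpha_prod k w)" by auto
  from Suc.IH[OF k ab(3)] obtain z where z: "\<And>w. w \<in> bits k \<Longrightarrow> z w \<in> adjoin {r t}"
    "b = (\<Sum>w\<in>bits k. z w * alpha_prod k w)" by auto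
  define Y where "Y s = (let w = restrict s {1..k} in if s (Suc k) = 0 then y w + z w else y w - z w)" for s
  have Y: "Y (w(Suc k := 0)) = y w + z w" "Y (w(Suc k := 1)) = y w - z w" if "w \<in> bits k" for w
    using bits_restrict[OF that] by (simp_all add: Y_def)
  \<comment> \<open>The two conjugate halves have sum \<open>1\<close> and difference the square root itself.\<close>
  have "x = (\<Sum>w\<in>bits k. (y w + z w) * (alpha_prod k w * alpha_bit (Suc k) 0) + (y w - z w) * (alpha_prod k w * alpha_bit (Suc k) 1))"
    unfolding ab(1) y(2) z(2) sum_distrib_right sum.distrib[symmetric]
    by (intro sum.cong refl) (simp add: alpha_bit_def field_simps)
  also have "\<dots> = (\<Sum>s\<in>bits (Suc k). Y s * alpha_prod (Suc k) s)"
    unfolding sum_bits_Suc by (intro sum.cong refl) (simp only: Y alpha_prod_Suc)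
  finally have "x = (\<Sum>s\<in>bits (Suc k). Y s * alpha_prod (Suc k) s)" .
  moreover have "Y s \<in> adjoin {r t}" if "s \<in> bits (Suc k)" for s
    using that y(1) z(1) Y by (elim bits_SucE) (auto intro!: adjoin_add adjoin_diff)
  ultimately show ?case by blast
qed

section \<open>The integral basis of the genus field\<close>

lemma algebraic_int_alpha_bit:
  assumes "i \<in> {1..t-1}"
  shows "algebraic_int (alpha_bit i e)"
proof -
  from q_mod_4[OF assms] obtain k where k: "1 - q i = 4 * k" by auto
  have "(alpha_bit i e)\<^sup>2 + of_int (-1) * alpha_bit i e + of_int k = ((r i)\<^sup>2 - 1) / 4 + of_int k"
    by (auto simp: alpha_bit_def power2_eq_square field_simps)
  also have "\<dots> = (of_int (4 * k) - of_int (1 - q i)) / 4"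
    using r_sq[of i] assms by (auto simp: field_simps)
  also have "\<dots> = 0" using k by simp
  finally show ?thesis by (rule algebraic_int_quadratic)
qed

lemma algebraic_int_alpha_prod: "k \<le> t - 1 \<Longrightarrow> algebraic_int (alpha_prod k w)"
  unfolding alpha_prod_def by (intro algebraic_int_prod algebraic_int_alpha_bit) auto

lemma alpha_t_sq: "(r t / 2)\<^sup>2 = of_int (disc_core t)"
  using root_core_sq[of t] ut by (simp add: root_core_def)

lemma algebraic_int_alpha_t: "algebraic_int (r t / 2)"
  by (rule algebraic_int_quadratic[of _ 0 "- disc_core t"]) (simp add: alpha_t_sq)

lemma odd_prod_q: "odd (\<Prod>i\<in>{1..t-1}. q i)"
  using odd_q by (auto simp: even_prod_iff)

text \<open>Squares are \<open>0\<close> or \<open>1\<close> modulo \<open>4\<close>, so \<open>A\<^sup>2 + B\<^sup>2\<close> and \<open>A\<^sup>2 + 2 B\<^sup>2\<close> are divisible by \<open>4\<close> only if \<open>A\<close> and \<open>B\<close> are even.\<close>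

lemma mod_4_sum_squares:
  fixes A B :: int
  assumes "odd M" "4 dvd M * (A\<^sup>2 - B\<^sup>2 * disc_core t)"
  shows "even A \<and> even B"
proof -
  have "coprime (2 ^ 2) M" using assms(1) by (intro coprime_power_left_iff[THEN iffD2]) simp
  hence "coprime 4 M" by simp
  hence d: "4 dvd A\<^sup>2 - B\<^sup>2 * disc_core t" using assms(2) by (simp only: coprime_dvd_mult_right_iff)
  from disc_core_t d have ht: "disc_core t = -1 \<or> disc_core t = -2" by auto
  obtain a where a: "A = 2 * a \<or> A = 2 * a + 1" by (metis evenE oddE)
  obtain b where b: "B = 2 * b \<or> B = 2 * b + 1" by (metis evenE oddE)
  from d obtain c where c: "A\<^sup>2 - B\<^sup>2 * disc_core t = 4 * c" by auto
  show ?thesis using a b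
  proof (elim disjE)
    assume "A = 2 * a + 1" "B = 2 * b"
    hence "A\<^sup>2 = 4 * (a\<^sup>2 + a) + 1" "B\<^sup>2 = 4 * b\<^sup>2" by (simp_all add: power2_eq_square algebra_simps)
    thus ?thesis using ht c by presburger
  next
    assume "A = 2 * a" "B = 2 * b + 1"
    hence "A\<^sup>2 = 4 * a\<^sup>2" "B\<^sup>2 = 4 * (b\<^sup>2 + b) + 1" by (simp_all add: power2_eq_square algebra_simps)
    thus ?thesis using ht c by presburger
  next
    assume "A = 2 * a + 1" "B = 2 * b + 1"
    hence "A\<^sup>2 = 4 * (a\<^sup>2 + a) + 1" "B\<^sup>2 = 4 * (b\<^sup>2 + b) + 1" by (simp_all add: power2_eq_square algebra_simps)
    thus ?thesis using ht c by presburger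
  qed auto
qed

text \<open>Write \<open>y = a + b \<alpha>\<^sub>t\<close> with rational \<open>a\<close>, \<open>b\<close> and let \<open>M = R\<^sup>2\<close>. The algebraic integer \<open>z = R y\<close> and its companion
\<open>z' = R (a - b \<alpha>\<^sub>t)\<close> have the integers \<open>z z'\<close> and \<open>z\<^sup>2 + z'\<^sup>2\<close> as symmetric functions. Combining them,
\<open>(2 a)\<^sup>2 M\<close> and \<open>(2 b)\<^sup>2 \<alpha>\<^sub>t\<^sup>2 M\<close> are integers. Both multipliers are squarefree, so \<open>2 a\<close> and \<open>2 b\<close> are integers, and
since \<open>M\<close> is odd, the integrality of \<open>z z'\<close> makes them even.\<close>

lemma integral_coefficient:
  assumes y: "y \<in> adjoin {r t}" and int: "algebraic_int (root_prod * y)"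
  shows "\<exists>a b :: int. y = of_int a + of_int b * (r t / 2)"
proof -
  let ?\<alpha> = "r t / 2"
  define M where "M = (\<Prod>i\<in>{1..t-1}. q i)"
  have t: "t \<in> {1..t}" using ut by simp
  have "(r t)\<^sup>2 \<in> adjoin {}" unfolding r_sq[OF t] by (rule adjoin_of_int)
  from adjoin_insert_sqrt[OF this] obtain y0 y1 where y01: "y0 \<in> \<rat>" "y1 \<in> \<rat>" "y = y0 + y1 * r t"
    using y by (auto simp: adjoin_empty)
  define a b where "a = y0" and "b = 2 * y1"
  have ab: "a \<in> \<rat>" "b \<in> \<rat>" "y = a + b * ?\<alpha>" using y01 by (auto simp: a_def b_def)
  have cnj_rat: "cnj z = z" if "z \<in> \<rat>" for z using that by (auto elim: Rats_cases')
  have root_prod_sq: "root_prod\<^sup>2 = of_int M"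
    unfolding M_def prod_power_distrib of_int_prod by (intro prod.cong refl r_sq) auto
  have "(cnj root_prod)\<^sup>2 = root_prod\<^sup>2" by (metis root_prod_sq complex_cnj_of_int complex_cnj_power)
  hence cnj_root_prod: "cnj root_prod = root_prod \<or> cnj root_prod = - root_prod" by (simp add: power2_eq_iff)
  \<comment> \<open>Complex conjugation provides the companion, since \<open>R\<close> is real or purely imaginary.\<close>
  have "cnj (root_prod * y) = cnj root_prod * (a - b * ?\<alpha>)"
    using ab cnj_r_neg[of t] ut by (simp add: cnj_rat)
  hence int_cnj: "algebraic_int (cnj root_prod * (a - b * ?\<alpha>))" using algebraic_int_cnj[OF int] by (simp only:)
  have int': "algebraic_int (root_prod * (a - b * ?\<alpha>))" (is "algebraic_int ?z'")
    using cnj_root_prod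
  proof
    assume "cnj root_prod = root_prod"
    with int_cnj show ?thesis by (simp only:)
  next
    assume "cnj root_prod = - root_prod"
    with int_cnj show ?thesis by (simp only: mult_minus_left algebraic_int_minus_iff)
  qed
  let ?z = "root_prod * y"
  have \<alpha>_sq: "?\<alpha>\<^sup>2 = of_int (disc_core t)" by (rule alpha_t_sq)
  have norm: "?z * ?z' = (a\<^sup>2 - b\<^sup>2 * of_int (disc_core t)) * of_int M"
    unfolding root_prod_sq[symmetric] \<alpha>_sq[symmetric] ab(3) by (simp add: power2_eq_square algebra_simps)
  have trace: "?z\<^sup>2 + ?z'\<^sup>2 = 2 * (a\<^sup>2 + b\<^sup>2 * of_int (disc_core t)) * of_int M"
    unfolding root_prod_sq[symmetric] \<alpha>_sq[symmetric] ab(3) by (simp add: power2_eq_square algebra_simps)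
  have "?z * ?z' \<in> \<int>"
  proof (rule rational_algebraic_int_is_int)
    show "algebraic_int (?z * ?z')" by (intro algebraic_int_add_mult int int')
    show "?z * ?z' \<in> \<rat>" unfolding norm using ab by auto
  qed
  hence norm_int: "(a\<^sup>2 - b\<^sup>2 * of_int (disc_core t)) * of_int M \<in> \<int>" unfolding norm .
  have "?z\<^sup>2 + ?z'\<^sup>2 \<in> \<int>"
  proof (rule rational_algebraic_int_is_int)
    show "algebraic_int (?z\<^sup>2 + ?z'\<^sup>2)"
      unfolding power2_eq_square by (intro algebraic_int_add_mult int int')
    show "?z\<^sup>2 + ?z'\<^sup>2 \<in> \<rat>" unfolding trace using ab by auto
  qed
  hence trace_int: "2 * (a\<^sup>2 + b\<^sup>2 * of_int (disc_core t)) * of_int M \<in> \<int>" unfolding trace .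
  have "(2 * a)\<^sup>2 * of_int M = 2 * (a\<^sup>2 + b\<^sup>2 * of_int (disc_core t)) * of_int M + 2 * ((a\<^sup>2 - b\<^sup>2 * of_int (disc_core t)) * of_int M)"
    by (simp add: algebra_simps)
  also have "\<dots> \<in> \<int>" by (intro Ints_add Ints_mult norm_int trace_int) simp
  finally have a_int: "(2 * a)\<^sup>2 * of_int M \<in> \<int>" .
  have "(2 * b)\<^sup>2 * of_int (disc_core t * M) = 2 * (a\<^sup>2 + b\<^sup>2 * of_int (disc_core t)) * of_int M - 2 * ((a\<^sup>2 - b\<^sup>2 * of_int (disc_core t)) * of_int M)"
    by (simp add: algebra_simps)
  also have "\<dots> \<in> \<int>" by (intro Ints_diff Ints_mult norm_int trace_int) simp
  finally have b_int: "(2 * b)\<^sup>2 * of_int (disc_core t * M) \<in> \<int>" .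
  have prod_disc_core: "(\<Prod>i\<in>{1..t-1}. disc_core i) = M" unfolding M_def using ut by (intro prod.cong refl) (auto simp: disc_core_def)
  have "{1..t} = insert t {1..t-1}" using ut by auto
  hence prod_disc_core': "(\<Prod>i\<in>{1..t}. disc_core i) = disc_core t * M" using prod_disc_core ut by simp
  have "2 * a \<in> \<int>"
    by (rule integral_if_square_times_squarefree_integral[OF _ _ a_int])
      (use ab squarefree_prod_disc_core[of "{1..t-1}"] prod_disc_core in auto)
  then obtain A where A: "2 * a = of_int A" by (auto elim: Ints_cases)
  have "2 * b \<in> \<int>"
    by (rule integral_if_square_times_squarefree_integral[OF _ _ b_int])
      (use ab squarefree_prod_disc_core[of "{1..t}"] prod_disc_core' in auto)
  then obtain B where B: "2 * b = of_int B" by (auto elim: Ints_cases)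
  from norm_int obtain k where k: "(a\<^sup>2 - b\<^sup>2 * of_int (disc_core t)) * of_int M = of_int k"
    by (auto elim: Ints_cases)
  have "complex_of_int (M * (A\<^sup>2 - B\<^sup>2 * disc_core t)) = of_int M * ((2 * a)\<^sup>2 - (2 * b)\<^sup>2 * of_int (disc_core t))"
    unfolding A B by simp
  also have "\<dots> = 4 * ((a\<^sup>2 - b\<^sup>2 * of_int (disc_core t)) * of_int M)" by (simp add: algebra_simps)
  also have "\<dots> = of_int (4 * k)" unfolding k by simp
  finally have "M * (A\<^sup>2 - B\<^sup>2 * disc_core t) = 4 * k" unfolding of_int_eq_iff .
  hence "even A \<and> even B" by (intro mod_4_sum_squares[OF odd_prod_q[folded M_def]]) simp
  then obtain A' B' where "A = 2 * A'" "B = 2 * B'" by (auto elim!: evenE)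
  hence "a = of_int A'" "b = of_int B'" using A B by simp_all
  thus ?thesis using ab by blast
qed

text \<open>The coefficients of \<open>x\<close> are extracted by the signed trace, which preserves integrality and leaves only the factor \<open>R\<close>.\<close>

theorem integral_basis_of_genus_field:
  assumes x: "x \<in> adjoin gens" and int: "algebraic_int x"
  shows "\<exists>a b :: (nat \<Rightarrow> nat) \<Rightarrow> int.
    x = (\<Sum>w\<in>bits (t-1). (of_int (a w) + of_int (b w) * (r t / 2)) * alpha_prod (t-1) w)"
proof -
  have "{1..t} = insert t {1..t-1}" using ut by auto
  hence "gens = insert (r t) (r ` {1..t-1})" by (simp only: image_insert)
  with x alpha_prod_expansion[of "t-1" x] obtain y where y: "\<And>w. w \<in> bits (t-1) \<Longrightarrow> y w \<in> adjoin {r t}"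
    "x = (\<Sum>w\<in>bits (t-1). y w * alpha_prod (t-1) w)" by auto
  have "\<exists>a b :: int. y v = of_int a + of_int b * (r t / 2)" if v: "v \<in> bits (t-1)" for v
  proof (rule integral_coefficient[OF y(1)[OF v]])
    have "algebraic_int (sign_trace (x * alpha_prod (t-1) v))"
      by (intro sign_trace_algebraic_int adjoin_mult algebraic_int_add_mult x int alpha_prod_in_K algebraic_int_alpha_prod) simp_all
    hence "algebraic_int (sgn_bits (t-1) v * (y v * sgn_bits (t-1) v * root_prod))"
      using sign_trace_coefficient[OF v y(1)] y(2) by (cases "even (\<Sum>i\<in>{1..t-1}. v i)") (simp_all add: sgn_bits_def)
    also have "sgn_bits (t-1) v * (y v * sgn_bits (t-1) v * root_prod) = root_prod * y v"
      using sgn_bits_sq[of "t-1" v] by (simp add: algebra_simps)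
    finally show "algebraic_int (root_prod * y v)" .
  qed
  then obtain a b where ab: "\<And>v. v \<in> bits (t-1) \<Longrightarrow> y v = of_int (a v :: int) + of_int (b v :: int) * (r t / 2)"
    by metis
  show ?thesis by (intro exI[of _ a] exI[of _ b]) (simp add: y(2) ab cong: sum.cong)
qed

section \<open>Eigenspaces of complex conjugation\<close>

text \<open>The action of complex conjugation on indices: it exchanges \<open>\<alpha>\<^sub>i\<close> and its conjugate exactly if \<open>q i < 0\<close>.\<close>

definition flip :: "nat \<Rightarrow> (nat \<Rightarrow> nat) \<Rightarrow> nat \<Rightarrow> nat" where
  "flip k w i = (if i \<in> {u<..k} then 1 - w i else w i)"

lemma flip_bits: "w \<in> bits k \<Longrightarrow> flip k w \<in> bits k"
  by (auto simp: bits_def flip_def PiE_iff extensional_def)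

lemma flip_flip: "w \<in> bits k \<Longrightarrow> flip k (flip k w) = w"
proof
  fix i assume "w \<in> bits k"
  thus "flip k (flip k w) i = w i"
    using bits_01[of w k i] by (auto simp: flip_def)
qed

lemma bij_flip: "bij_betw (flip k) (bits k) (bits k)"
  by (rule bij_betw_byWitness[of _ "flip k"]) (auto simp: flip_bits flip_flip)

lemma flip_Suc: "u \<le> k \<Longrightarrow> flip (Suc k) (w(Suc k := e)) = (flip k w)(Suc k := 1 - e)"
  by (auto simp: flip_def fun_eq_iff)

text \<open>Each of the \<open>k - u\<close> flipped bits contributes a factor \<open>-1\<close>.\<close>

lemma sgn_bits_flip:
  assumes "w \<in> bits k" "u \<le> k"
  shows "sgn_bits k (flip k w) = (-1) ^ (k - u) * sgn_bits k w"
proof -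
  have split: "{1..k} = {1..u} \<union> {u+1..k}" using assms by auto
  have prods: "(\<Prod>i\<in>{1..k}. f i) = (\<Prod>i\<in>{1..u}. f i) * (\<Prod>i\<in>{u+1..k}. f i)" for f :: "nat \<Rightarrow> complex"
    unfolding split by (intro prod.union_disjoint) auto
  have "(\<Prod>i\<in>{1..u}. (-1) ^ flip k w i) = (\<Prod>i\<in>{1..u}. (-1 :: complex) ^ w i)"
    by (intro prod.cong refl) (auto simp: flip_def)
  moreover have "(\<Prod>i\<in>{u+1..k}. (-1) ^ flip k w i) = (\<Prod>i\<in>{u+1..k}. (-1) * (-1 :: complex) ^ w i)"
  proof (intro prod.cong refl)
    fix i assume i: "i \<in> {u+1..k}"
    hence "w i = 0 \<or> w i = 1" using bits_01[OF assms(1), of i] by auto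
    thus "(-1) ^ flip k w i = (-1) * (-1 :: complex) ^ w i" using i by (auto simp: flip_def)
  qed
  ultimately show ?thesis
    unfolding sgn_bits_def power_sum prods prod.distrib by simp
qed

lemma cnj_alpha_bit:
  assumes "i \<in> {1..t-1}" "w i = 0 \<or> w i = 1" "i \<le> k"
  shows "cnj (alpha_bit i (w i)) = alpha_bit i (flip k w i)"
proof (cases "i \<le> u")
  case True
  thus ?thesis using assms cnj_r_pos[of i] by (auto simp: alpha_bit_def flip_def)
next
  case False
  hence "cnj (r i) = - r i" using assms by (intro cnj_r_neg) auto
  thus ?thesis using assms False by (auto simp: alpha_bit_def flip_def)
qed

lemma cnj_alpha_prod:
  assumes "w \<in> bits k" "k \<le> t - 1"
  shows "cnj (alpha_prod k w) = alpha_prod k (flip k w)"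
  unfolding alpha_prod_def cnj_prod
proof (intro prod.cong refl cnj_alpha_bit)
  fix i assume "i \<in> {1..k}"
  thus "w i = 0 \<or> w i = 1" using bits_01[OF assms(1)] by blast
qed (use assms in auto)

text \<open>The basis element \<open>E w' \<alpha>\<^sub>t\<^sup>e\<close>, where \<open>w'\<close> extends \<open>w\<close> by a last bit \<open>0\<close>, plus \<open>\<kappa>\<close> times its complex conjugate. As
the last bit is among the flipped ones, every orbit of \<open>flip\<close> has exactly one such \<open>w'\<close>.\<close>

definition conj_eigen :: "complex \<Rightarrow> (nat \<Rightarrow> nat) \<Rightarrow> nat \<Rightarrow> complex" where
  "conj_eigen \<kappa> w e = alpha_prod (t-1) (w(t-1 := 0)) * (r t / 2) ^ e
     + \<kappa> * (alpha_prod (t-1) (flip (t-1) (w(t-1 := 0))) * (- (r t / 2)) ^ e)"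

lemma last_index_Suc: "t - 1 = Suc (t - 2)" using ut by simp

lemma u_le_index: "u \<le> t - 2" using ut by simp

lemma flip_last: "flip (t-1) (w(t-1 := e)) = (flip (t-2) w)(t-1 := 1 - e)"
  unfolding last_index_Suc by (rule flip_Suc[OF u_le_index])

lemma bits_upd_last: "w \<in> bits (t-2) \<Longrightarrow> e \<in> {0, 1} \<Longrightarrow> w(t-1 := e) \<in> bits (t-1)"
  unfolding last_index_Suc by (rule bits_upd)

lemma restrict_upd_last: "w \<in> bits (t-2) \<Longrightarrow> restrict (w(t-1 := e)) {1..t-2} = w"
  unfolding last_index_Suc by (rule bits_restrict)

lemma bits_lastE:
  assumes "s \<in> bits (t-1)"
  obtains w e where "w \<in> bits (t-2)" "e = 0 \<or> e = 1" "s = w(t-1 := e)"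
  using assms unfolding last_index_Suc by (rule bits_SucE)

lemma sum_bits_last:
  fixes g :: "(nat \<Rightarrow> nat) \<Rightarrow> complex"
  shows "(\<Sum>s\<in>bits (t-1). g s) = (\<Sum>w\<in>bits (t-2). g (w(t-1 := 0)) + g (w(t-1 := 1)))"
  unfolding last_index_Suc by (rule sum_bits_Suc)

lemma cnj_alpha_t: "cnj (r t / 2) = - (r t / 2)"
  using cnj_r_neg[of t] ut by simp

text \<open>If the last bit is \<open>1\<close>, the index belongs to the conjugate of the basis element with the flipped index, whose last bit is
\<open>0\<close>; hence the flip of \<open>w\<close> and the sign of \<open>b\<close>.\<close>

definition conj_eigen_coeff :: "complex \<Rightarrow> ((nat \<Rightarrow> nat) \<Rightarrow> int) \<Rightarrow> ((nat \<Rightarrow> nat) \<Rightarrow> int) \<Rightarrow> (nat \<Rightarrow> nat) \<Rightarrow> complex" where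
  "conj_eigen_coeff \<kappa> a b s = (let w = restrict s {1..t-2} in
     if s (t-1) = 0 then of_int (a w) + of_int (b w) * (r t / 2)
     else \<kappa> * (of_int (a (flip (t-2) w)) - of_int (b (flip (t-2) w)) * (r t / 2)))"

lemma conj_eigen_coeff_upd:
  assumes "w \<in> bits (t-2)"
  shows "conj_eigen_coeff \<kappa> a b (w(t-1 := 0)) = of_int (a w) + of_int (b w) * (r t / 2)"
    and "conj_eigen_coeff \<kappa> a b (w(t-1 := 1)) =
      \<kappa> * (of_int (a (flip (t-2) w)) - of_int (b (flip (t-2) w)) * (r t / 2))"
  unfolding conj_eigen_coeff_def restrict_upd_last[OF assms] by (simp_all add: Let_def)

lemma sum_conj_eigen:
  "(\<Sum>w\<in>bits (t-2). of_int (a w) * conj_eigen \<kappa> w 0 + of_int (b w) * conj_eigen \<kappa> w 1)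
     = (\<Sum>s\<in>bits (t-1). conj_eigen_coeff \<kappa> a b s * alpha_prod (t-1) s)"
proof -
  let ?B = "bits (t-2)"
  let ?g = "\<lambda>w. conj_eigen_coeff \<kappa> a b (w(t-1 := 1)) * alpha_prod (t-1) (w(t-1 := 1))"
  have "(\<Sum>s\<in>bits (t-1). conj_eigen_coeff \<kappa> a b s * alpha_prod (t-1) s)
      = (\<Sum>w\<in>?B. conj_eigen_coeff \<kappa> a b (w(t-1 := 0)) * alpha_prod (t-1) (w(t-1 := 0))) + (\<Sum>w\<in>?B. ?g w)"
    unfolding sum_bits_last sum.distrib ..
  also have "(\<Sum>w\<in>?B. ?g w) = (\<Sum>w\<in>?B. ?g (flip (t-2) w))"
    by (rule sum.reindex_bij_betw[OF bij_flip, symmetric])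
  also have "(\<Sum>w\<in>?B. conj_eigen_coeff \<kappa> a b (w(t-1 := 0)) * alpha_prod (t-1) (w(t-1 := 0))) + (\<Sum>w\<in>?B. ?g (flip (t-2) w))
      = (\<Sum>w\<in>?B. of_int (a w) * conj_eigen \<kappa> w 0 + of_int (b w) * conj_eigen \<kappa> w 1)"
    unfolding sum.distrib[symmetric]
  proof (intro sum.cong refl)
    fix w assume w: "w \<in> ?B"
    show "conj_eigen_coeff \<kappa> a b (w(t-1 := 0)) * alpha_prod (t-1) (w(t-1 := 0)) + ?g (flip (t-2) w)
      = of_int (a w) * conj_eigen \<kappa> w 0 + of_int (b w) * conj_eigen \<kappa> w 1"
      unfolding conj_eigen_coeff_upd[OF w] conj_eigen_coeff_upd[OF flip_bits[OF w]] flip_flip[OF w] conj_eigen_def flip_last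
      by (simp add: algebra_simps)
  qed
  finally show ?thesis by simp
qed

lemma conj_eigen_coeff_in: "\<kappa> = 1 \<or> \<kappa> = -1 \<Longrightarrow> conj_eigen_coeff \<kappa> a b s \<in> adjoin {r t}"
proof -
  assume "\<kappa> = 1 \<or> \<kappa> = -1"
  hence "\<kappa> \<in> adjoin {r t}" by (auto intro: adjoin_intros)
  moreover have "r t \<in> adjoin {r t}" by (rule adjoin_gen) simp
  ultimately show ?thesis unfolding conj_eigen_coeff_def Let_def
    by (auto intro!: adjoin_mult adjoin_add adjoin_diff adjoin_of_int adjoin_divide adjoin_numeral)
qed

lemma coeffs_zero:
  assumes "of_int a + of_int b * (r t / 2) = 0"
  shows "a = 0" "b = 0"
proof -
  have "cnj (of_int a + of_int b * (r t / 2)) = 0" using assms by (simp only: complex_cnj_zero)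
  hence *: "of_int a - of_int b * (r t / 2) = 0"
    by (simp only: complex_cnj_add complex_cnj_mult complex_cnj_of_int cnj_alpha_t mult_minus_right add_uminus_conv_diff)
  have "(2 :: complex) * of_int a = (of_int a + of_int b * (r t / 2)) + (of_int a - of_int b * (r t / 2))"
    by simp
  also have "\<dots> = 0" unfolding assms * by simp
  finally show "a = 0" by simp
  with assms have "of_int b * (r t / 2) = 0" by simp
  thus "b = 0" using r_nonzero[of t] ut by simp
qed

lemma conj_eigen_independent:
  assumes \<kappa>: "\<kappa> = 1 \<or> \<kappa> = -1"
    and zero: "(\<Sum>w\<in>bits (t-2). of_int (a w) * conj_eigen \<kappa> w 0 + of_int (b w) * conj_eigen \<kappa> w 1) = 0"
    and w: "w \<in> bits (t-2)"
  shows "a w = 0 \<and> b w = 0"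
proof -
  have "conj_eigen_coeff \<kappa> a b (w(t-1 := 0)) = 0"
  proof (rule alpha_prod_coefficients_unique[of "conj_eigen_coeff \<kappa> a b" "\<lambda>_. 0"])
    show "(\<Sum>s\<in>bits (t-1). conj_eigen_coeff \<kappa> a b s * alpha_prod (t-1) s) = (\<Sum>s\<in>bits (t-1). 0 * alpha_prod (t-1) s)"
      using zero unfolding sum_conj_eigen by simp
  qed (use conj_eigen_coeff_in[OF \<kappa>] adjoin_0 bits_upd_last[OF w] in auto)
  thus ?thesis using coeffs_zero unfolding conj_eigen_coeff_upd[OF w] by blast
qed

lemma cnj_conj_eigen:
  assumes "\<kappa> = 1 \<or> \<kappa> = -1" "w \<in> bits (t-2)"
  shows "cnj (conj_eigen \<kappa> w e) = \<kappa> * conj_eigen \<kappa> w e"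
proof -
  have s: "w(t-1 := 0) \<in> bits (t-1)" using assms by (intro bits_upd_last) auto
  have "cnj \<kappa> = \<kappa>" "\<kappa> * \<kappa> = 1" using assms by auto
  moreover have "cnj (conj_eigen \<kappa> w e) = alpha_prod (t-1) (flip (t-1) (w(t-1 := 0))) * (- (r t / 2)) ^ e
     + cnj \<kappa> * (alpha_prod (t-1) (w(t-1 := 0)) * (r t / 2) ^ e)"
    unfolding conj_eigen_def
    by (simp only: complex_cnj_add complex_cnj_mult complex_cnj_power complex_cnj_minus cnj_alpha_t
        minus_minus cnj_alpha_prod[OF s order_refl] cnj_alpha_prod[OF flip_bits[OF s] order_refl] flip_flip[OF s])
  ultimately show ?thesis unfolding conj_eigen_def distrib_left mult.assoc[symmetric] by (simp add: add.commute)
qed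

lemma conj_eigen_in_K: "\<kappa> = 1 \<or> \<kappa> = -1 \<Longrightarrow> conj_eigen \<kappa> w e \<in> adjoin gens"
proof -
  assume "\<kappa> = 1 \<or> \<kappa> = -1"
  hence "\<kappa> \<in> adjoin gens" by (auto intro: adjoin_intros)
  moreover have "r t \<in> adjoin gens" using ut by (intro r_in_K) simp
  ultimately show ?thesis unfolding conj_eigen_def
    by (intro adjoin_add adjoin_mult adjoin_power adjoin_uminus adjoin_divide adjoin_numeral alpha_prod_in_K) simp_all
qed

lemma algebraic_int_conj_eigen: "\<kappa> = 1 \<or> \<kappa> = -1 \<Longrightarrow> algebraic_int (conj_eigen \<kappa> w e)"
proof -
  assume "\<kappa> = 1 \<or> \<kappa> = -1"
  hence "algebraic_int \<kappa>" by auto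
  moreover have power: "algebraic_int (z ^ n)" if "algebraic_int z" for z :: complex and n
    using that by (induction n) (auto intro: algebraic_int_add_mult)
  ultimately show ?thesis unfolding conj_eigen_def
    by (intro algebraic_int_add_mult power algebraic_int_alpha_prod algebraic_int_minus algebraic_int_alpha_t) simp_all
qed

text \<open>Comparing coefficients in \<open>cnj x = \<kappa> x\<close> shows that the coefficients at the two members of an orbit of \<open>flip\<close> determine each
other, so \<open>x\<close> is a combination of orbit sums.\<close>

lemma conj_eigen_spans:
  assumes \<kappa>: "\<kappa> = 1 \<or> \<kappa> = -1"
    and x: "x \<in> adjoin gens" "algebraic_int x" "cnj x = \<kappa> * x"
  shows "\<exists>a b :: (nat \<Rightarrow> nat) \<Rightarrow> int.
    x = (\<Sum>w\<in>bits (t-2). of_int (a w) * conj_eigen \<kappa> w 0 + of_int (b w) * conj_eigen \<kappa> w 1)"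
proof -
  from integral_basis_of_genus_field[OF x(1,2)] obtain a b :: "(nat \<Rightarrow> nat) \<Rightarrow> int" where
    ab: "x = (\<Sum>s\<in>bits (t-1). (of_int (a s) + of_int (b s) * (r t / 2)) * alpha_prod (t-1) s)" by blast
  define y where "y s = of_int (a s) + of_int (b s) * (r t / 2)" for s
  have xy: "x = (\<Sum>s\<in>bits (t-1). y s * alpha_prod (t-1) s)" unfolding ab y_def ..
  have rt: "r t \<in> adjoin {r t}" by (rule adjoin_gen) simp
  have y_in: "y s \<in> adjoin {r t}" for s unfolding y_def by (intro adjoin_intros rt)
  have cnj_y: "cnj (y s) = of_int (a s) - of_int (b s) * (r t / 2)" for s
    unfolding y_def
    by (simp only: complex_cnj_add complex_cnj_mult complex_cnj_of_int cnj_alpha_t mult_minus_right add_uminus_conv_diff)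
  have cnj_y_in: "cnj (y s) \<in> adjoin {r t}" for s unfolding cnj_y by (intro adjoin_intros rt)
  have \<kappa>_in: "\<kappa> \<in> adjoin {r t}" using \<kappa> by (auto intro: adjoin_intros)
  \<comment> \<open>Conjugation permutes the basis by \<open>flip\<close>; comparing coefficients in \<open>cnj x = \<kappa> x\<close> ties the
     coefficient at a flipped index to the conjugate of the original one.\<close>
  have "(\<Sum>s\<in>bits (t-1). (\<kappa> * y s) * alpha_prod (t-1) s) = \<kappa> * x"
    unfolding xy by (simp add: sum_distrib_left mult.assoc)
  also have "\<dots> = cnj x" by (rule x(3)[symmetric])
  also have "\<dots> = (\<Sum>s\<in>bits (t-1). cnj (y s) * alpha_prod (t-1) (flip (t-1) s))"
    unfolding xy cnj_sum complex_cnj_mult by (intro sum.cong refl) (simp only: cnj_alpha_prod)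
  also have "\<dots> = (\<Sum>s\<in>bits (t-1). cnj (y (flip (t-1) s)) * alpha_prod (t-1) (flip (t-1) (flip (t-1) s)))"
    by (rule sum.reindex_bij_betw[OF bij_flip, symmetric])
  also have "\<dots> = (\<Sum>s\<in>bits (t-1). cnj (y (flip (t-1) s)) * alpha_prod (t-1) s)"
    by (intro sum.cong refl) (simp only: flip_flip)
  finally have coeff: "\<kappa> * y s = cnj (y (flip (t-1) s))" if "s \<in> bits (t-1)" for s
    by (rule alpha_prod_coefficients_unique[rotated 2]) (use that \<kappa>_in y_in cnj_y_in in \<open>auto intro: adjoin_mult\<close>)
  let ?a = "\<lambda>w. a (w(t-1 := 0))" and ?b = "\<lambda>w. b (w(t-1 := 0))"
  have "y s = conj_eigen_coeff \<kappa> ?a ?b s" if s: "s \<in> bits (t-1)" for s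
  proof -
    from s obtain w e where w: "w \<in> bits (t-2)" "e = 0 \<or> e = 1" "s = w(t-1 := e)" by (rule bits_lastE)
    show ?thesis
    proof (cases "e = 0")
      case True
      thus ?thesis unfolding w(3) by (simp only: conj_eigen_coeff_upd[OF w(1)] y_def)
    next
      case False
      hence e: "e = 1" using w by simp
      have "\<kappa> * y s = cnj (y ((flip (t-2) w)(t-1 := 0)))"
        using coeff[OF s] unfolding w(3) e flip_last by simp
      hence "\<kappa> * (\<kappa> * y s) = \<kappa> * cnj (y ((flip (t-2) w)(t-1 := 0)))" by (simp only:)
      moreover have "\<kappa> * (\<kappa> * y s) = y s" using \<kappa> by auto
      ultimately show ?thesis unfolding w(3) e conj_eigen_coeff_upd[OF w(1)] cnj_y by (simp only:)
    qed
  qed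
  hence "x = (\<Sum>s\<in>bits (t-1). conj_eigen_coeff \<kappa> ?a ?b s * alpha_prod (t-1) s)"
    unfolding xy by (intro sum.cong refl) (simp only:)
  hence "x = (\<Sum>w\<in>bits (t-2). of_int (?a w) * conj_eigen \<kappa> w 0 + of_int (?b w) * conj_eigen \<kappa> w 1)"
    unfolding sum_conj_eigen .
  thus ?thesis by (rule exI[of _ ?b, THEN exI[of _ ?a]])
qed

text \<open>Changing signs by \<open>g\<close> and relabelling the exponents of \<open>\<alpha>\<^sub>t\<close> by \<open>p\<close> does not affect the property of being a basis. For
\<open>\<beta>\<^sup>*\<close> both occur: its sign is that of \<open>w\<close>, and the exponent is one minus the last bit.\<close>

lemma is_Z_basis_conj_eigen:
  fixes f :: "(nat \<Rightarrow> nat) \<Rightarrow> complex" and g :: "(nat \<Rightarrow> nat) \<Rightarrow> int" and p :: "nat \<Rightarrow> nat"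
  assumes \<kappa>: "\<kappa> = 1 \<or> \<kappa> = -1"
    and f: "\<And>w e. w \<in> bits (t-2) \<Longrightarrow> e \<in> {0, 1} \<Longrightarrow> f (w(t-1 := e)) = of_int (g w) * conj_eigen \<kappa> w (p e)"
    and g: "\<And>w. g w = 1 \<or> g w = -1"
    and p: "(p 0 = 0 \<and> p 1 = 1) \<or> (p 0 = 1 \<and> p 1 = 0)"
  shows "is_Z_basis (f ` bits (t-1)) {x \<in> adjoin gens. algebraic_int x \<and> cnj x = \<kappa> * x}"
proof (rule is_Z_basis_image)
  show "finite (bits (t-1))" by (rule finite_bits)
  have sum_f: "(\<Sum>s\<in>bits (t-1). of_int (k s) * f s) =
      (\<Sum>w\<in>bits (t-2). of_int (g w * k (w(t-1 := p 0))) * conj_eigen \<kappa> w 0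
        + of_int (g w * k (w(t-1 := p 1))) * conj_eigen \<kappa> w 1)" for k
    unfolding sum_bits_last using p by (intro sum.cong refl) (auto simp: f)
  fix k assume "(\<Sum>s\<in>bits (t-1). of_int (k s) * f s) = 0"
  hence *: "g w * k (w(t-1 := p 0)) = 0 \<and> g w * k (w(t-1 := p 1)) = 0" if "w \<in> bits (t-2)" for w
    unfolding sum_f by (rule conj_eigen_independent[OF \<kappa> _ that])
  show "\<forall>s\<in>bits (t-1). k s = 0"
  proof
    fix s assume "s \<in> bits (t-1)"
    then obtain w e where w: "w \<in> bits (t-2)" "e = 0 \<or> e = 1" "s = w(t-1 := e)" by (rule bits_lastE)
    have "g w \<noteq> 0" using g[of w] by auto
    thus "k s = 0" using *[OF w(1)] w(2,3) p by auto
  qed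
next
  fix x
  show "x \<in> {x \<in> adjoin gens. algebraic_int x \<and> cnj x = \<kappa> * x} \<longleftrightarrow>
      (\<exists>k. x = (\<Sum>s\<in>bits (t-1). of_int (k s) * f s))"
  proof
    assume "x \<in> {x \<in> adjoin gens. algebraic_int x \<and> cnj x = \<kappa> * x}"
    then obtain a b :: "(nat \<Rightarrow> nat) \<Rightarrow> int" where
      x: "x = (\<Sum>w\<in>bits (t-2). of_int (a w) * conj_eigen \<kappa> w 0 + of_int (b w) * conj_eigen \<kappa> w 1)"
      using conj_eigen_spans[OF \<kappa>] by blast
    define k where "k s = (let w = restrict s {1..t-2} in g w * (if s (t-1) = p 0 then a w else b w))" for s
    have k: "k (w(t-1 := e)) = g w * (if e = p 0 then a w else b w)" if "w \<in> bits (t-2)" for w e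
      unfolding k_def restrict_upd_last[OF that] by (simp add: Let_def)
    have "x = (\<Sum>s\<in>bits (t-1). of_int (k s) * f s)"
      unfolding x sum_bits_last
    proof (intro sum.cong refl)
      fix w assume w: "w \<in> bits (t-2)"
      have e: "of_int (k (w(t-1 := e))) * f (w(t-1 := e))
          = of_int (if e = p 0 then a w else b w) * conj_eigen \<kappa> w (p e)" if "e \<in> {0, 1}" for e
        unfolding k[OF w] f[OF w that] using g[of w] by auto
      show "of_int (a w) * conj_eigen \<kappa> w 0 + of_int (b w) * conj_eigen \<kappa> w 1 =
          of_int (k (w(t-1 := 0))) * f (w(t-1 := 0)) + of_int (k (w(t-1 := 1))) * f (w(t-1 := 1))"
        using e[of 0] e[of 1] p by auto
    qed
    thus "\<exists>k. x = (\<Sum>s\<in>bits (t-1). of_int (k s) * f s)" by blast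
  next
    assume "\<exists>k. x = (\<Sum>s\<in>bits (t-1). of_int (k s) * f s)"
    then obtain k where x: "x = (\<Sum>s\<in>bits (t-1). of_int (k s) * f s)" by blast
    have fs: "f s \<in> adjoin gens \<and> algebraic_int (f s) \<and> cnj (f s) = \<kappa> * f s" if "s \<in> bits (t-1)" for s
    proof -
      from that obtain w e where w: "w \<in> bits (t-2)" "e = 0 \<or> e = 1" "s = w(t-1 := e)" by (rule bits_lastE)
      have "f s = of_int (g w) * conj_eigen \<kappa> w (p e)" unfolding w(3) using w(2) by (intro f w(1)) auto
      thus ?thesis
        using cnj_conj_eigen[OF \<kappa> w(1)] conj_eigen_in_K[OF \<kappa>] algebraic_int_conj_eigen[OF \<kappa>]
        by (auto intro!: adjoin_mult adjoin_of_int algebraic_int_add_mult)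
    qed
    have "x \<in> adjoin gens" unfolding x using fs by (intro adjoin_sum adjoin_mult adjoin_of_int) blast
    moreover have "algebraic_int x"
      unfolding x using fs by (intro algebraic_int_sum algebraic_int_add_mult algebraic_int_of_int) blast
    moreover have "cnj x = \<kappa> * x"
      unfolding x cnj_sum complex_cnj_mult sum_distrib_left complex_cnj_of_int
      by (intro sum.cong refl) (simp add: fs)
    ultimately show "x \<in> {x \<in> adjoin gens. algebraic_int x \<and> cnj x = \<kappa> * x}" by blast
  qed
qed

section \<open>The families beta and beta star\<close>

text \<open>The four kinds of factors in the definitions of \<open>\<beta>\<close> and \<open>\<beta>\<^sup>*\<close>, written as signed \<open>alpha_bit\<close> factors.\<close>

lemma alpha_bit_alpha:
  assumes "i \<in> {1..t-1}" "e = 0 \<or> e = 1"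
  shows "alpha_conj r i ^ e * alpha t r i ^ (1 - e) = alpha_bit i e"
    and "alpha_conj r i ^ (1 - e) * alpha t r i ^ e = alpha_bit i (1 - e)"
    and "(- alpha_conj r i) ^ e * alpha t r i ^ (1 - e) = (-1) ^ e * alpha_bit i e"
    and "alpha_conj r i ^ (1 - e) * (- alpha t r i) ^ e = (-1) ^ e * alpha_bit i (1 - e)"
  using assms ut by (auto simp: alpha_conj_def alpha_def alpha_bit_def)

lemma prod_split: "(\<Prod>i\<in>{1..u}. f i) * (\<Prod>i\<in>{u+1..t-2}. f i) = (\<Prod>i\<in>{1..t-2}. f i)"
  for f :: "nat \<Rightarrow> complex"
proof -
  have "{1..t-2} = {1..u} \<union> {u+1..t-2}" using u_le_index by auto
  thus ?thesis by (simp add: prod.union_disjoint)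
qed

lemma alpha_prod_last: "alpha_prod (t-1) (w(t-1 := e)) = alpha_prod (t-2) w * alpha_bit (t-1) e"
  unfolding last_index_Suc by (rule alpha_prod_Suc)

lemma sgn_bits_last: "sgn_bits (t-1) (w(t-1 := e)) = (-1) ^ e * sgn_bits (t-2) w"
  unfolding last_index_Suc by (rule sgn_bits_Suc)

lemma alpha_last: "alpha t r (t-1) = alpha_bit (t-1) 0" "alpha_conj r (t-1) = alpha_bit (t-1) 1" "alpha t r t = r t / 2"
  using ut by (auto simp: alpha_def alpha_conj_def alpha_bit_def)

lemma beta_eq:
  assumes w: "w \<in> bits (t-2)" and e: "e \<in> {0, 1}"
  shows "beta t u r (w(t-1 := e)) = conj_eigen 1 w e"
proof -
  have wi: "i \<in> {1..t-1}" "w i = 0 \<or> w i = 1" if "i \<in> {1..t-2}" for i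
    using that bits_01[OF w that] by auto
  have upd: "(w(t-1 := e)) i = w i" if "i \<in> {1..t-2}" for i using that by auto
  have A: "(\<Prod>i\<in>{1..u}. alpha_conj r i ^ (w(t-1 := e)) i * alpha t r i ^ (1 - (w(t-1 := e)) i))
      = (\<Prod>i\<in>{1..u}. alpha_bit i (w i))"
    "(\<Prod>i\<in>{u+1..t-2}. alpha_conj r i ^ (w(t-1 := e)) i * alpha t r i ^ (1 - (w(t-1 := e)) i))
      = (\<Prod>i\<in>{u+1..t-2}. alpha_bit i (w i))"
    using u_le_index by (auto simp del: fun_upd_apply intro!: prod.cong simp: upd alpha_bit_alpha(1)[OF wi])
  have B: "(\<Prod>i\<in>{u+1..t-2}. alpha_conj r i ^ (1 - (w(t-1 := e)) i) * alpha t r i ^ (w(t-1 := e)) i)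
      = (\<Prod>i\<in>{u+1..t-2}. alpha_bit i (flip (t-2) w i))"
    using u_le_index by (auto simp del: fun_upd_apply intro!: prod.cong simp: upd alpha_bit_alpha(2)[OF wi] flip_def)
  have C: "(\<Prod>i\<in>{1..u}. alpha_bit i (w i)) = (\<Prod>i\<in>{1..u}. alpha_bit i (flip (t-2) w i))"
    by (intro prod.cong refl) (auto simp: flip_def)
  have "beta t u r (w(t-1 := e)) =
     (\<Prod>i\<in>{1..u}. alpha_bit i (w i)) * (\<Prod>i\<in>{u+1..t-2}. alpha_bit i (w i)) * alpha_bit (t-1) 0 * (r t / 2) ^ e
     + (\<Prod>i\<in>{1..u}. alpha_bit i (flip (t-2) w i)) * (\<Prod>i\<in>{u+1..t-2}. alpha_bit i (flip (t-2) w i))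
       * alpha_bit (t-1) 1 * (- (r t / 2)) ^ e"
    unfolding beta_def Let_def A B alpha_last fun_upd_same C[symmetric] by (simp only: algebra_simps)
  also have "\<dots> = conj_eigen 1 w e"
    unfolding prod_split conj_eigen_def flip_last alpha_prod_last unfolding alpha_prod_def by simp
  finally show ?thesis .
qed

lemma beta_star_eq:
  assumes w: "w \<in> bits (t-2)" and e: "e \<in> {0, 1}"
  shows "beta_star t u r (w(t-1 := e)) = sgn_bits (t-2) w * conj_eigen (-1) w (1 - e)"
proof -
  have wi: "i \<in> {1..t-1}" "w i = 0 \<or> w i = 1" if "i \<in> {1..t-2}" for i
    using that bits_01[OF w that] by auto
  have upd: "(w(t-1 := e)) i = w i" if "i \<in> {1..t-2}" for i using that by auto
  have A: "(\<Prod>i\<in>{1..u}. (- alpha_conj r i) ^ (w(t-1 := e)) i * alpha t r i ^ (1 - (w(t-1 := e)) i))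
      = (\<Prod>i\<in>{1..u}. (-1) ^ w i * alpha_bit i (w i))"
    "(\<Prod>i\<in>{u+1..t-2}. (- alpha_conj r i) ^ (w(t-1 := e)) i * alpha t r i ^ (1 - (w(t-1 := e)) i))
      = (\<Prod>i\<in>{u+1..t-2}. (-1) ^ w i * alpha_bit i (w i))"
    using u_le_index by (auto simp del: fun_upd_apply intro!: prod.cong simp: upd alpha_bit_alpha(3)[OF wi])
  have B: "(\<Prod>i\<in>{u+1..t-2}. alpha_conj r i ^ (1 - (w(t-1 := e)) i) * (- alpha t r i) ^ (w(t-1 := e)) i)
      = (\<Prod>i\<in>{u+1..t-2}. (-1) ^ w i * alpha_bit i (flip (t-2) w i))"
    using u_le_index by (auto simp del: fun_upd_apply intro!: prod.cong simp: upd alpha_bit_alpha(4)[OF wi] flip_def)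
  have C: "(\<Prod>i\<in>{1..u}. (-1) ^ w i * alpha_bit i (w i)) = (\<Prod>i\<in>{1..u}. (-1) ^ w i * alpha_bit i (flip (t-2) w i))"
    by (intro prod.cong refl) (auto simp: flip_def)
  have "beta_star t u r (w(t-1 := e)) =
     (\<Prod>i\<in>{1..u}. (-1) ^ w i * alpha_bit i (w i)) * (\<Prod>i\<in>{u+1..t-2}. (-1) ^ w i * alpha_bit i (w i))
       * alpha_bit (t-1) 0 * (r t / 2) ^ (1 - e)
     - (\<Prod>i\<in>{1..u}. (-1) ^ w i * alpha_bit i (flip (t-2) w i)) * (\<Prod>i\<in>{u+1..t-2}. (-1) ^ w i * alpha_bit i (flip (t-2) w i))
       * alpha_bit (t-1) 1 * (- (r t / 2)) ^ (1 - e)"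
    unfolding beta_star_def Let_def A B alpha_last fun_upd_same C[symmetric] by (simp only: algebra_simps)
  also have "\<dots> = sgn_bits (t-2) w * conj_eigen (-1) w (1 - e)"
    unfolding prod_split conj_eigen_def flip_last alpha_prod_last
    unfolding alpha_prod_def prod.distrib sgn_bits_def power_sum
    by (simp add: algebra_simps)
  finally show ?thesis .
qed

lemma real_iff_cnj: "x \<in> \<real> \<longleftrightarrow> cnj x = 1 * x"
  by (simp add: Reals_cnj_iff)

lemma imaginary_iff_cnj: "x \<in> {\<i> * complex_of_real y | y. True} \<longleftrightarrow> cnj x = -1 * x"
proof -
  have "x \<in> {\<i> * complex_of_real y | y. True} \<longleftrightarrow> Re x = 0"
    by (auto simp: complex_eq_iff intro: exI[of _ "Im x"])
  thus ?thesis by (auto simp: complex_eq_iff)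
qed

theorem beta_basis:
  "is_Z_basis (beta t u r ` bits (t-1)) (ring_of_integers (genus_field t r \<inter> \<real>))"
proof -
  have "ring_of_integers (genus_field t r \<inter> \<real>) = {x \<in> adjoin gens. algebraic_int x \<and> cnj x = 1 * x}"
    unfolding ring_of_integers_def genus_field_eq real_iff_cnj[symmetric] by blast
  thus ?thesis
    using is_Z_basis_conj_eigen[of 1 "beta t u r" "\<lambda>_. 1" "\<lambda>e. e"] by (simp add: beta_eq)
qed

theorem beta_star_basis:
  "is_Z_basis (beta_star t u r ` bits (t-1))
     (ring_of_integers (genus_field t r) \<inter> {\<i> * complex_of_real y | y. True})"
proof -
  have "ring_of_integers (genus_field t r) \<inter> {\<i> * complex_of_real y | y. True}
      = {x \<in> adjoin gens. algebraic_int x \<and> cnj x = -1 * x}"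
    unfolding ring_of_integers_def genus_field_eq using imaginary_iff_cnj by blast
  moreover have "is_Z_basis (beta_star t u r ` bits (t-1)) {x \<in> adjoin gens. algebraic_int x \<and> cnj x = -1 * x}"
  proof (rule is_Z_basis_conj_eigen)
    show "beta_star t u r (w(t-1 := e)) = of_int ((-1) ^ (\<Sum>i\<in>{1..t-2}. w i)) * conj_eigen (-1) w (1 - e)"
      if "w \<in> bits (t-2)" "e \<in> {0, 1}" for w e
      unfolding beta_star_eq[OF that] sgn_bits_def by simp
    show "(-1 :: int) ^ (\<Sum>i\<in>{1..t-2}. w i) = 1 \<or> (-1 :: int) ^ (\<Sum>i\<in>{1..t-2}. w i) = -1" for w
      by (cases "even (\<Sum>i\<in>{1..t-2}. w i)") simp_all
  qed auto
  ultimately show ?thesis by simp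
qed

lemma odd_number_of_negatives:
  assumes "(\<Prod>i\<in>{1..t}. q i) < 0"
  shows "odd (t - u)"
proof
  assume even: "even (t - u)"
  have "{1..t} = {1..u} \<union> {u<..t}" using ut by auto
  hence "(\<Prod>i\<in>{1..t}. q i) = (\<Prod>i\<in>{1..u}. q i) * (\<Prod>i\<in>{u<..t}. q i)"
    by (simp only:) (intro prod.union_disjoint, auto)
  also have "(\<Prod>i\<in>{u<..t}. q i) = (\<Prod>i\<in>{u<..t}. (-1) * (- q i))" by simp
  also have "\<dots> = (\<Prod>i\<in>{u<..t}. - q i)" unfolding prod.distrib using even by simp
  also have "(\<Prod>i\<in>{1..u}. q i) * \<dots> > 0"
    using q_pos q_neg by (intro mult_pos_pos prod_pos) auto
  finally show False using assms by simp
qed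

text \<open>Since \<open>t - u\<close> is odd, an even number of bits is flipped altogether, so the two diagonal terms carry the same sign.\<close>

theorem duality:
  assumes odd: "odd (t - u)" and \<eta>: "\<eta> \<in> bits (t-1)" and \<nu>: "\<nu> \<in> bits (t-1)"
  shows "sign_trace (beta t u r \<eta> * beta_star t u r \<nu>) = (if \<eta> = \<nu> then \<Prod>i\<in>{1..t}. r i else 0)"
proof -
  let ?\<alpha> = "r t / 2"
  obtain w k where w: "w \<in> bits (t-2)" "k = 0 \<or> k = 1" "\<eta> = w(t-1 := k)" using \<eta> by (rule bits_lastE)
  obtain v l where v: "v \<in> bits (t-2)" "l = 0 \<or> l = 1" "\<nu> = v(t-1 := l)" using \<nu> by (rule bits_lastE)
  define w0 w1 v0 v1 where "w0 = w(t-1 := 0)" and "w1 = (flip (t-2) w)(t-1 := 1)"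
    and "v0 = v(t-1 := 0)" and "v1 = (flip (t-2) v)(t-1 := 1)"
  note defs = w0_def w1_def v0_def v1_def
  have bits: "w0 \<in> bits (t-1)" "w1 \<in> bits (t-1)" "v0 \<in> bits (t-1)" "v1 \<in> bits (t-1)"
    unfolding defs by (auto intro!: bits_upd_last w v flip_bits)
  have flips: "flip (t-1) w0 = w1" "flip (t-1) v0 = v1"
    unfolding defs flip_last by simp_all
  have inj: "x(t-1 := e) = y(t-1 := e') \<longleftrightarrow> x = y \<and> e = e'"
    if "x \<in> bits (t-2)" "y \<in> bits (t-2)" for x y :: "nat \<Rightarrow> nat" and e e'
    using that restrict_upd_last by (metis fun_upd_same)
  note fw = flip_bits[OF w(1)] and fv = flip_bits[OF v(1)]
  have flip_inj: "flip (t-2) w = flip (t-2) v \<longleftrightarrow> w = v"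
    by (metis flip_flip w(1) v(1))
  have neq: "w0 \<noteq> v1" "w1 \<noteq> v0"
    unfolding defs inj[OF w(1) fv] inj[OF fw v(1)] by simp_all
  have eq0: "w0 = v0 \<longleftrightarrow> w = v" and eq1: "w1 = v1 \<longleftrightarrow> w = v"
    unfolding defs inj[OF w(1) v(1)] inj[OF fw fv] flip_inj by simp_all
  have eq: "\<eta> = \<nu> \<longleftrightarrow> w = v \<and> k = l"
    unfolding w(3) v(3) by (rule inj[OF w(1) v(1)])
  define s where "s = sgn_bits (t-2) v"
  have s0: "sgn_bits (t-1) v0 = s" unfolding v0_def sgn_bits_last s_def by simp
  have "odd (t - 2 - u)" using odd ut by auto
  hence s1: "sgn_bits (t-1) v1 = s"
    unfolding v1_def sgn_bits_last sgn_bits_flip[OF v(1) u_le_index] s_def by simp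
  have ss: "s * s = 1" unfolding s_def by (rule sgn_bits_sq)
  have beta: "beta t u r \<eta> = alpha_prod (t-1) w0 * ?\<alpha> ^ k + alpha_prod (t-1) w1 * (- ?\<alpha>) ^ k"
    unfolding w(3) beta_eq[OF w(1), of k, simplified, OF w(2)] conj_eigen_def w0_def[symmetric] flips by simp
  have beta_star: "beta_star t u r \<nu> = s * (alpha_prod (t-1) v0 * ?\<alpha> ^ (1-l) - alpha_prod (t-1) v1 * (- ?\<alpha>) ^ (1-l))"
    unfolding v(3) beta_star_eq[OF v(1), of l, simplified, OF v(2)] conj_eigen_def v0_def[symmetric] flips s_def by simp
  define g00 g01 g10 g11 where "g00 = s * (?\<alpha> ^ k * ?\<alpha> ^ (1-l))" and "g01 = - s * (?\<alpha> ^ k * (- ?\<alpha>) ^ (1-l))"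
    and "g10 = s * ((- ?\<alpha>) ^ k * ?\<alpha> ^ (1-l))" and "g11 = - s * ((- ?\<alpha>) ^ k * (- ?\<alpha>) ^ (1-l))"
  note g_defs = g00_def g01_def g10_def g11_def
  have rt: "r t \<in> adjoin {r t}" by (rule adjoin_gen) simp
  have s_in: "s \<in> adjoin {r t}" unfolding s_def sgn_bits_def by (intro adjoin_power adjoin_uminus adjoin_1)
  have g_in: "g00 \<in> adjoin {r t}" "g01 \<in> adjoin {r t}" "g10 \<in> adjoin {r t}" "g11 \<in> adjoin {r t}"
    unfolding g_defs
    by (intro adjoin_mult adjoin_power adjoin_uminus adjoin_divide adjoin_numeral rt s_in)+
  let ?t = "\<lambda>g x y. g * (alpha_prod (t-1) x * alpha_prod (t-1) y)"
  have in_K: "?t g x y \<in> adjoin gens" if "g \<in> adjoin {r t}" for g x y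
    by (intro adjoin_mult adjoin_last_subset[OF that] alpha_prod_in_K) simp_all
  have sign_trace_add: "sign_trace (x + y) = sign_trace x + sign_trace y" if "x \<in> adjoin gens" "y \<in> adjoin gens" for x y
    using sign_trace_sum[of "{0, 1 :: nat}" "\<lambda>i. if i = 0 then x else y"] that by simp
  have "sign_trace (beta t u r \<eta> * beta_star t u r \<nu>) = sign_trace (?t g00 w0 v0 + (?t g01 w0 v1 + (?t g10 w1 v0 + ?t g11 w1 v1)))"
    unfolding beta beta_star g_defs by (rule arg_cong[of _ _ sign_trace]) (simp add: algebra_simps)
  also have "\<dots> = sign_trace (?t g00 w0 v0) + (sign_trace (?t g01 w0 v1) + (sign_trace (?t g10 w1 v0) + sign_trace (?t g11 w1 v1)))"
    by (simp only: sign_trace_add in_K g_in adjoin_add)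
  \<comment> \<open>The mixed terms vanish since their last bits differ.\<close>
  also have "\<dots> = (if w = v then (g00 + g11) * s * root_prod else 0)"
  proof (cases "w = v")
    case True
    hence "w0 = v0" "w1 = v1" using eq0 eq1 by simp_all
    thus ?thesis using True neq s0 s1 by (simp add: sign_trace_dual bits g_in distrib_right)
  next
    case False
    hence "w0 \<noteq> v0" "w1 \<noteq> v1" using eq0 eq1 by simp_all
    thus ?thesis using False neq by (simp add: sign_trace_dual bits g_in)
  qed
  also have "\<dots> = (if w = v then (?\<alpha> ^ k * ?\<alpha> ^ (1-l) - (- ?\<alpha>) ^ k * (- ?\<alpha>) ^ (1-l)) * root_prod else 0)"
  proof -
    have "(g00 + g11) * s = (s * s) * (?\<alpha> ^ k * ?\<alpha> ^ (1-l) - (- ?\<alpha>) ^ k * (- ?\<alpha>) ^ (1-l))"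
      unfolding g_defs by (simp add: left_diff_distrib right_diff_distrib distrib_right mult_ac)
    thus ?thesis unfolding ss by simp
  qed
  also have "\<dots> = (if w = v \<and> k = l then r t * root_prod else 0)"
    using w(2) v(2) by auto
  also have "r t * root_prod = (\<Prod>i\<in>{1..t}. r i)"
  proof -
    have "{1..t} = insert t {1..t-1}" using ut by auto
    thus ?thesis using ut by simp
  qed
  finally show ?thesis unfolding eq .
qed

end


theorem theorem11:
  fixes d :: int and t u :: nat and q :: "nat \<Rightarrow> int" and r :: "nat \<Rightarrow> complex"
    and K :: "complex set"
  assumes "d < 0"
    and "\<exists>F. imaginary_quadratic_field F \<and> is_discriminant_of_quadratic_field F d"
    and "prime_discriminant_factorization d t q"
    and "u + 2 \<le> t"
    and "q t \<in> {-4, -8}"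
    and "\<forall>i\<in>{1..t-1}. odd (q i)"
    and "\<forall>i\<in>{1..u}. q i > 0"
    and "\<forall>i\<in>{u<..t}. q i < 0"
    and "\<forall>i\<in>{1..t}. (r i)\<^sup>2 = of_int (q i)"
    and "K = genus_field t r"
  shows "is_Z_basis (beta t u r ` bits (t-1)) (ring_of_integers (K \<inter> \<real>)) \<and>
         is_Z_basis (beta_star t u r ` bits (t-1))
           (ring_of_integers K \<inter> {\<i> * complex_of_real y | y. True}) \<and>
         (\<forall>\<eta>\<in>bits (t-1). \<forall>\<nu>\<in>bits (t-1).
           (\<Sum>\<mu>\<in>bits (t-1). (-1) ^ (\<Sum>i\<in>{1..t-1}. \<mu> i)
              * tau_prod t r \<mu> (beta t u r \<eta> * beta_star t u r \<nu>))
           = (if \<eta> = \<nu> then (\<Prod>i\<in>{1..t}. r i) else 0))"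
proof -
  interpret prime_discriminant_roots t u q r
    by unfold_locales (use assms in \<open>auto simp: prime_discriminant_factorization_def\<close>)
  have "(\<Prod>i\<in>{1..t}. q i) < 0"
    using assms(1,3) by (simp add: prime_discriminant_factorization_def)
  hence "odd (t - u)" by (rule odd_number_of_negatives)
  thus ?thesis
    using beta_basis beta_star_basis duality unfolding assms(10) sign_trace_def sgn_bits_def by blast
qed

end
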